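(* Let $\Omega\subset\mathbb{C}^2$ be a bounded strongly pseudoconvex complete circular domain with smooth boundary, and let $S=\partial\Omega$. Then $S$ contains at least one circle of projective-umbilic points, i.e. there is a circle contained in $S$ every point of which is a projective-umbilic point of $S$.
   Context: A domain $\Omega\subset\mathbb{C}^2$ is complete circular if $\lambda z=(\lambda z_1,\lambda z_2)\in\Omega$ whenever $z=(z_1,z_2)\in\Omega$ and $\lambda\in\mathbb{C}$ with $|\lambda|\le 1$. Smooth means $C^\infty$. "Circle" means an ordinary round circle (of positive radius) in $\mathbb{C}^2\cong\mathbb{R}^4$. Projective-umbilic points. Let $S\subset\mathbb{C}^2$ be a smooth strongly pseudoconvex real hypersurface. A point $p\in S$ is projective-umbilic if some projective image of the unit sphere $\{|z_1|^2+|z_2|^2=1\}$ (that is, its image under an automorphism of $\mathbb{CP}^2$, where $\mathbb{C}^2\subset\mathbb{CP}^2$ in the standard way) passes through $p$ and has order of contact at least three with $S$ at $p$. The convention for order of contact is the "point-contact order": tangency alone is contact of order at least two, and contact of order at least three means that, when the two hypersurfaces are written near $p$ as graphs over their common real tangent space at $p$, the graphing functions differ by $O(\|x\|^3)$, i.e. agree through second order. Equivalently, the projective-umbilic points of $S$ are precisely the points where the tensor $$\mathscr{B}_S = -\frac{\det\begin{pmatrix}0&r_1&r_2\\ r_1&r_{11}&r_{21}\\ r_2&r_{12}&r_{22}\end{pmatrix}}{\det\begin{pmatrix}0&r_1&r_2\\ r_{\bar 1}&r_{1\bar 1}&r_{2\bar 1}\\ r_{\bar 2}&r_{1\bar 2}&r_{2\bar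 2}\end{pmatrix}}\cdot\frac{dz_1\wedge dz_2}{d\overline{z_1}\wedge d\overline{z_2}}$$ vanishes. Here $r$ is any smooth real-valued defining function for $S$ (so $S=\{r=0\}$ locally and $dr\neq0$ on $S$), and subscripts $j$, $\bar j$ denote differentiation with respect to $z_j$, $\overline{z_j}$. The denominator is nonzero on $S$ because $S$ is strongly pseudoconvex. In other words, $p\in S$ is projective-umbilic exactly when the determinant in the numerator vanishes at $p$. *)

theory Defs
  imports "HOL-Analysis.Analysis" "HOL-Library.Landau_Symbols"
begin

text \<open>\<open>Ck_on k U f\<close> is meant for open \<open>U\<close>: all iterated directional derivatives of order
  at most \<open>k\<close> exist in the Frechet sense and are continuous.\<close>

primrec Ck_on ::
  "nat \<Rightarrow> 'a::real_normed_vector set \<Rightarrow> ('a \<Rightarrow> 'b::real_normed_vector) \<Rightarrow> bool"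
where
  "Ck_on 0 U f \<longleftrightarrow> continuous_on U f"
| "Ck_on (Suc k) U f \<longleftrightarrow>
     (\<forall>x\<in>U. f differentiable (at x)) \<and>
     (\<forall>v. Ck_on k U (\<lambda>x. frechet_derivative f (at x) v))"

definition smooth_on ::
  "'a::real_normed_vector set \<Rightarrow> ('a \<Rightarrow> 'b::real_normed_vector) \<Rightarrow> bool"
where
  "smooth_on U f \<longleftrightarrow> (\<forall>k. Ck_on k U f)"

definition wirtinger :: "'n \<Rightarrow> (complex^'n \<Rightarrow> complex) \<Rightarrow> complex^'n \<Rightarrow> complex"
where
  "wirtinger j f z =
     (frechet_derivative f (at z) (axis j 1) - \<i> * frechet_derivative f (at z) (axis j \<i>)) / 2"

definition wirtinger_bar :: "'n \<Rightarrow> (complex^'n \<Rightarrow> complex) \<Rightarrow> complex^'n \<Rightarrow> complex"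
where
  "wirtinger_bar j f z =
     (frechet_derivative f (at z) (axis j 1) + \<i> * frechet_derivative f (at z) (axis j \<i>)) / 2"

text \<open>For open \<open>\<Omega>\<close> the conditions imply
  \<open>frontier \<Omega> \<inter> U = {z \<in> U. r z = 0}\<close>.\<close>

definition local_defining_function ::
  "'a::real_normed_vector set \<Rightarrow> 'a set \<Rightarrow> ('a \<Rightarrow> real) \<Rightarrow> bool"
where
  "local_defining_function \<Omega> U r \<longleftrightarrow>
     open U \<and> smooth_on U r \<and> \<Omega> \<inter> U = {z \<in> U. r z < 0} \<and>
     (\<forall>z\<in>U. r z = 0 \<longrightarrow> (\<exists>v. frechet_derivative r (at z) v \<noteq> 0))"

definition smooth_boundary :: "'a::real_normed_vector set \<Rightarrow> bool"
where
  "smooth_boundary \<Omega> \<longleftrightarrow>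
     (\<forall>p\<in>frontier \<Omega>. \<exists>U r. p \<in> U \<and> local_defining_function \<Omega> U r)"

text \<open>The Levi form of a real-valued function is Hermitian, so its diagonal values are real
  and taking the real part loses nothing.\<close>

definition levi_positive_at :: "(complex^'n \<Rightarrow> real) \<Rightarrow> complex^'n \<Rightarrow> bool"
where
  "levi_positive_at r p \<longleftrightarrow>
     (let \<rho> = (\<lambda>z. complex_of_real (r z)) in
      \<forall>w. w \<noteq> 0 \<and> (\<Sum>j\<in>UNIV. wirtinger j \<rho> p * w $ j) = 0 \<longrightarrow>
        Re (\<Sum>j\<in>UNIV. \<Sum>k\<in>UNIV.
              wirtinger_bar k (wirtinger j \<rho>) p * w $ j * cnj (w $ k)) > 0)"

text \<open>Positivity of the Levi form on the complex tangent space does not depend on the choice of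
  the defining function, so it is enough to ask for one.\<close>

definition strongly_pseudoconvex :: "(complex^'n) set \<Rightarrow> bool"
where
  "strongly_pseudoconvex \<Omega> \<longleftrightarrow>
     (\<forall>p\<in>frontier \<Omega>. \<exists>U r. p \<in> U \<and> local_defining_function \<Omega> U r \<and> levi_positive_at r p)"

definition complete_circular :: "(complex^'n) set \<Rightarrow> bool"
where
  "complete_circular \<Omega> \<longleftrightarrow> (\<forall>z\<in>\<Omega>. \<forall>a. norm a \<le> 1 \<longrightarrow> a *s z \<in> \<Omega>)"

definition is_circle :: "'a::real_inner set \<Rightarrow> bool"
where
  "is_circle C \<longleftrightarrow>
     (\<exists>c \<rho> u v. \<rho> > 0 \<and> norm u = 1 \<and> norm v = 1 \<and> u \<bullet> v = 0 \<and>
        C = range (\<lambda>t. c + (\<rho> * cos t) *\<^sub>R u + (\<rho> * sin t) *\<^sub>R v))"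

text \<open>Near \<open>p\<close> the set \<open>S\<close> is the graph of \<open>f\<close>, in the direction of the unit vector \<open>\<nu>\<close>, over
  the hyperplane through \<open>p\<close> orthogonal to \<open>\<nu>\<close>; the vanishing of the derivative says that this
  hyperplane is the tangent space of \<open>S\<close> at \<open>p\<close>. Only the values of \<open>f\<close> on the orthogonal
  complement of \<open>\<nu>\<close> matter. There the germ of \<open>f\<close> at 0 is determined by \<open>S\<close>, \<open>p\<close> and \<open>\<nu>\<close>, so
  \<open>f\<close> is automatically smooth near 0 when \<open>S\<close> is a smooth hypersurface.\<close>

definition tangent_graph ::
  "'a::real_inner set \<Rightarrow> 'a \<Rightarrow> 'a \<Rightarrow> ('a \<Rightarrow> real) \<Rightarrow> bool"
where
  "tangent_graph S p \<nu> f \<longleftrightarrow>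
     norm \<nu> = 1 \<and> f 0 = 0 \<and>
     (f has_derivative (\<lambda>_. 0)) (at 0 within {x. x \<bullet> \<nu> = 0}) \<and>
     (\<forall>\<^sub>F q in nhds p.
        q \<in> S \<longleftrightarrow> (q - p) \<bullet> \<nu> = f (q - p - ((q - p) \<bullet> \<nu>) *\<^sub>R \<nu>))"

text \<open>Point-contact order: tangency alone is contact of order at least 2.\<close>

definition contact_order_ge ::
  "nat \<Rightarrow> 'a::real_inner set \<Rightarrow> 'a set \<Rightarrow> 'a \<Rightarrow> bool"
where
  "contact_order_ge m S T p \<longleftrightarrow>
     (\<exists>\<nu> f g. tangent_graph S p \<nu> f \<and> tangent_graph T p \<nu> g \<and>
        (\<lambda>x. f x - g x) \<in> O[at 0 within {x. x \<bullet> \<nu> = 0}](\<lambda>x. norm x ^ m))"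

text \<open>Homogeneous coordinates for the standard embedding of the affine plane into the projective
  plane, and the affine part of the image of \<open>X\<close> under the projective transformation induced by
  the matrix \<open>A\<close>.\<close>

definition homogeneous :: "complex^2 \<Rightarrow> complex^3"
where
  "homogeneous z = vector [1, z $ 1, z $ 2]"

definition projective_image :: "complex^3^3 \<Rightarrow> (complex^2) set \<Rightarrow> (complex^2) set"
where
  "projective_image A X =
     {z. \<exists>w\<in>X. \<exists>c. c \<noteq> 0 \<and> A *v homogeneous w = c *s homogeneous z}"

definition projective_umbilic :: "(complex^2) set \<Rightarrow> complex^2 \<Rightarrow> bool"
where
  "projective_umbilic S p \<longleftrightarrow>
     p \<in> S \<and>
     (\<exists>A. invertible A \<and> p \<in> projective_image A (sphere 0 1) \<and>
        contact_order_ge 3 S (projective_image A (sphere 0 1)) p)"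

end

theory Submission
  imports Defs
begin

text \<open>
  Let \<open>S = frontier \<Omega>\<close> and let \<open>N\<close> be the Minkowski gauge of \<open>\<Omega>\<close>, so that \<open>S = {N = 1}\<close>, and put
  \<open>H = N\<^sup>2\<close>. Since \<open>\<Omega>\<close> is complete circular, \<open>H (a z) = \<bar>a\<bar>\<^sup>2 H z\<close> for every complex \<open>a\<close>. The proof reads
  the umbilic condition off the second derivatives of \<open>H\<close> and then finds a solution by a winding
  number.

  \<^bold>\<open>Smoothness.\<close> The radial direction is transverse to \<open>S\<close> (\<open>radial_derivative_pos\<close>): otherwise the
  complex line through a boundary point would be tangent there, while the disc that it cuts out
  lies in the closed domain, against positivity of the Levi form. Hence \<open>N\<close> solves an implicit
  equation \<open>r (z / N z) = 0\<close> with nonzero radial derivative, and \<open>N\<close> is smooth away from the origin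
  (\<open>Ck_on_gauge\<close>).

  \<^bold>\<open>The obstruction.\<close> Homogeneity determines every second derivative of \<open>H\<close> at \<open>z\<close> in which one of
  the directions lies in the complex line of \<open>z\<close>. What remains is a real quadratic form on a
  complementary complex line, \<open>c \<bar>\<beta>\<bar>\<^sup>2 + Re (q \<beta>\<^sup>2)\<close>. If \<open>q = 0\<close> at \<open>p \<in> S\<close>, then the second-order Taylor
  polynomial of \<open>H\<close> at \<open>p\<close> is a Hermitian form \<open>L\<close> on \<open>\<complex>\<^sup>2\<close>, exactly and including the lower-order
  terms. By strong pseudoconvexity \<open>L\<close> is positive definite, so \<open>{L = 1}\<close> is a linear image of the
  unit sphere, and it agrees with \<open>S\<close> to third order at \<open>p\<close> (\<open>osculating_sphere\<close>). Passing from
  defining functions to graphs is \<open>contact_order_ge_of_defining_functions\<close>.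

  \<^bold>\<open>Existence of a zero.\<close> Using the complement spanned by the antilinear vector \<open>(-cnj z\<^sub>2, cnj z\<^sub>1)\<close>,
  the coefficient \<open>q\<close> becomes a continuous function with \<open>q (a z) = a\<^sup>-\<^sup>4 q z\<close> for \<open>\<bar>a\<bar> = 1\<close>, that is, a
  section of a nontrivial line bundle over the projective line. It has a zero
  (\<open>equivariant_map_has_zero\<close>), and by equivariance it vanishes along the whole circle
  \<open>{a p. \<bar>a\<bar> = 1}\<close>.
\<close>

section \<open>Calculus of continuously differentiable maps\<close>

text \<open>The direction comes first, so that \<open>dir_deriv v f\<close> is again a function of the base point
  and derivatives can be iterated.\<close>

abbreviation dir_deriv ::
  "'a::real_normed_vector \<Rightarrow> ('a \<Rightarrow> 'b::real_normed_vector) \<Rightarrow> 'a \<Rightarrow> 'b"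
where
  "dir_deriv v f x \<equiv> frechet_derivative f (at x) v"

lemma dir_deriv_eqI: "(f has_derivative f') (at x) \<Longrightarrow> dir_deriv v f x = f' v"
  using frechet_derivative_at by metis

lemma dir_deriv_cong_open:
  assumes "open U" "x \<in> U" "\<And>y. y \<in> U \<Longrightarrow> f y = g y" "f differentiable (at x)"
  shows "dir_deriv v f x = dir_deriv v g x"
  using frechet_derivative_transform_within_open[OF assms(4,1,2)] assms(3) by simp

lemma linear_dir_deriv:
  assumes "f differentiable (at x)"
  shows "dir_deriv (v + w) f x = dir_deriv v f x + dir_deriv w f x"
    and "dir_deriv (c *\<^sub>R v) f x = c *\<^sub>R dir_deriv v f x"
  using linear_frechet_derivative[OF assms]
  by (auto simp: linear_add linear_cmul)

lemma differentiable_transform_open: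
  assumes "open U" "x \<in> U" "\<And>y. y \<in> U \<Longrightarrow> f y = g y" "f differentiable (at x)"
  shows "g differentiable (at x)"
  using assms unfolding differentiable_def
  by (meson has_derivative_transform_within_open)

lemma Ck_on_cong:
  assumes "open U" "\<And>y. y \<in> U \<Longrightarrow> f y = g y" "Ck_on k U f"
  shows "Ck_on k U g"
  using assms
proof (induction k arbitrary: f g)
  case 0
  then show ?case using continuous_on_cong by (metis Ck_on.simps(1))
next
  case (Suc k)
  have d: "f differentiable (at x)" if "x \<in> U" for x
    using Suc.prems that by simp
  have "Ck_on k U (dir_deriv v g)" for v
  proof (rule Suc.IH[OF \<open>open U\<close>])
    show "Ck_on k U (dir_deriv v f)" using Suc.prems by simp
    show "dir_deriv v f y = dir_deriv v g y" if "y \<in> U" for y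
      using dir_deriv_cong_open[OF \<open>open U\<close> that] Suc.prems(2) d[OF that] by blast
  qed
  moreover have "g differentiable (at x)" if "x \<in> U" for x
    using differentiable_transform_open[OF \<open>open U\<close> that] Suc.prems(2) d[OF that] by blast
  ultimately show ?case by simp
qed

lemma Ck_on_subset: "Ck_on k U f \<Longrightarrow> V \<subseteq> U \<Longrightarrow> Ck_on k V f"
  by (induction k arbitrary: f) (auto intro: continuous_on_subset)

lemma Ck_on_SucD: "Ck_on (Suc k) U f \<Longrightarrow> Ck_on k U f"
proof (induction k arbitrary: f)
  case 0
  then show ?case
    by (auto intro!: differentiable_imp_continuous_on differentiable_at_imp_differentiable_on)
next
  case (Suc k)
  then show ?case by (metis Ck_on.simps(2))
qed

lemma Ck_on_continuous_on: "Ck_on k U f \<Longrightarrow> continuous_on U f"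
  by (induction k) (auto dest: Ck_on_SucD simp del: Ck_on.simps(2))

lemma Ck_on_dir_deriv: "Ck_on (Suc k) U f \<Longrightarrow> Ck_on k U (dir_deriv v f)"
  by simp

lemma Ck_on_differentiable: "Ck_on (Suc k) U f \<Longrightarrow> x \<in> U \<Longrightarrow> f differentiable (at x)"
  by simp

lemma Ck_on_has_derivative:
  "Ck_on (Suc k) U f \<Longrightarrow> x \<in> U \<Longrightarrow> (f has_derivative frechet_derivative f (at x)) (at x)"
  using frechet_derivative_works by auto

lemma Ck_on_local:
  assumes "\<And>x. x \<in> U \<Longrightarrow> \<exists>V. open V \<and> x \<in> V \<and> Ck_on k V f"
  shows "Ck_on k U f"
  using assms
proof (induction k arbitrary: f)
  case 0
  then show ?case
    by (auto intro!: continuous_at_imp_continuous_on simp: continuous_on_eq_continuous_at) 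
       (metis continuous_on_eq_continuous_at)
next
  case (Suc k)
  have "f differentiable (at x)" if "x \<in> U" for x
    using Suc.prems[OF that] by auto
  moreover have "Ck_on k U (dir_deriv v f)" for v
    by (rule Suc.IH) (use Suc.prems in \<open>fastforce\<close>)
  ultimately show ?case by simp
qed

text \<open>Checking \<open>C\<^sup>k\<^sup>+\<^sup>1\<close> only needs a formula for the derivative: the chosen value of
  \<open>frechet_derivative\<close> never has to be named.\<close>

lemma Ck_on_SucI:
  assumes "open U" "\<And>x. x \<in> U \<Longrightarrow> (f has_derivative (\<lambda>v. f' v x)) (at x)"
    and "\<And>v. Ck_on k U (f' v)"
  shows "Ck_on (Suc k) U f"
proof -
  have "Ck_on k U (dir_deriv v f)" for v
  proof (rule Ck_on_cong[OF assms(1) _ assms(3)[of v]])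
    show "f' v y = dir_deriv v f y" if "y \<in> U" for y
      using dir_deriv_eqI[OF assms(2)[OF that]] by simp
  qed
  then show ?thesis using assms(2) by (auto simp: differentiable_def)
qed

lemma Ck_on_const: "Ck_on k U (\<lambda>x. c)"
  by (induction k arbitrary: c) (auto intro: continuous_on_const)

lemma Ck_on_bounded_linear:
  assumes "bounded_linear L"
  shows "Ck_on k U L"
proof (cases k)
  case 0
  then show ?thesis using linear_continuous_on[OF assms] by simp
next
  case (Suc m)
  have d: "(L has_derivative L) (at x)" for x
    using bounded_linear_imp_has_derivative[OF assms] .
  then have "dir_deriv v L = (\<lambda>x. L v)" for v
    by (auto intro: dir_deriv_eqI)
  then show ?thesis using Suc d Ck_on_const by (auto simp: differentiable_def)
qed

lemma Ck_on_bounded_linear_compose: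
  assumes "bounded_linear L" "open U" "Ck_on k U f"
  shows "Ck_on k U (\<lambda>x. L (f x))"
  using assms(3)
proof (induction k arbitrary: f)
  case 0
  then show ?case
    using bounded_linear.continuous_on[OF assms(1)] by auto
next
  case (Suc k)
  have d: "((\<lambda>x. L (f x)) has_derivative (\<lambda>v. L (dir_deriv v f x))) (at x)" if "x \<in> U" for x
    using bounded_linear.has_derivative[OF assms(1) Ck_on_has_derivative[OF Suc.prems that]] .
  show ?case by (rule Ck_on_SucI[OF assms(2) d Suc.IH[OF Ck_on_dir_deriv[OF Suc.prems]]])
qed

lemma Ck_on_add:
  assumes "open U" "Ck_on k U f" "Ck_on k U g"
  shows "Ck_on k U (\<lambda>x. f x + g x)"
  using assms(2,3)
proof (induction k arbitrary: f g)
  case 0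
  then show ?case by (auto intro: continuous_on_add)
next
  case (Suc k)
  have d: "((\<lambda>x. f x + g x) has_derivative (\<lambda>v. dir_deriv v f x + dir_deriv v g x)) (at x)"
    if "x \<in> U" for x
    using has_derivative_add[OF Ck_on_has_derivative[OF Suc.prems(1) that]
        Ck_on_has_derivative[OF Suc.prems(2) that]] .
  show ?case
    by (rule Ck_on_SucI[OF assms(1) d], assumption)
      (rule Suc.IH[OF Ck_on_dir_deriv[OF Suc.prems(1)] Ck_on_dir_deriv[OF Suc.prems(2)]])
qed

lemma Ck_on_sum:
  assumes "open U" "finite I" "\<And>i. i \<in> I \<Longrightarrow> Ck_on k U (f i)"
  shows "Ck_on k U (\<lambda>x. \<Sum>i\<in>I. f i x)"
  using assms(2,3) by (induction I) (auto intro: Ck_on_const Ck_on_add[OF assms(1)])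

lemma Ck_on_scaleR:
  fixes f :: "'a::real_normed_vector \<Rightarrow> real"
  assumes "open U" "Ck_on k U f" "Ck_on k U g"
  shows "Ck_on k U (\<lambda>x. f x *\<^sub>R g x)"
  using assms(2,3)
proof (induction k arbitrary: f g)
  case 0
  then show ?case by (auto intro: continuous_on_scaleR)
next
  case (Suc k)
  have d: "((\<lambda>x. f x *\<^sub>R g x) has_derivative
      (\<lambda>v. f x *\<^sub>R dir_deriv v g x + dir_deriv v f x *\<^sub>R g x)) (at x)"
    if "x \<in> U" for x
    using has_derivative_scaleR[OF Ck_on_has_derivative[OF Suc.prems(1) that]
        Ck_on_has_derivative[OF Suc.prems(2) that]] .
  show ?case
    by (rule Ck_on_SucI[OF assms(1) d], assumption, rule Ck_on_add[OF assms(1)])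
      (rule Suc.IH Ck_on_dir_deriv Suc.prems Ck_on_SucD[OF Suc.prems(1)]
        Ck_on_SucD[OF Suc.prems(2)])+
qed

lemma Ck_on_mult:
  fixes f g :: "'a::real_normed_vector \<Rightarrow> real"
  assumes "open U" "Ck_on k U f" "Ck_on k U g"
  shows "Ck_on k U (\<lambda>x. f x * g x)"
  using Ck_on_scaleR[OF assms] by simp

lemma Ck_on_inverse:
  fixes f :: "'a::real_normed_vector \<Rightarrow> real"
  assumes "open U" "Ck_on k U f" "\<And>x. x \<in> U \<Longrightarrow> f x \<noteq> 0"
  shows "Ck_on k U (\<lambda>x. inverse (f x))"
  using assms(2)
proof (induction k)
  case 0
  then show ?case using assms(3) by (auto intro: continuous_on_inverse)
next
  case (Suc k)
  have d: "((\<lambda>x. inverse (f x)) has_derivative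
      (\<lambda>v. - (inverse (f x) * dir_deriv v f x * inverse (f x)))) (at x)"
    if "x \<in> U" for x
    using Deriv.has_derivative_inverse[OF assms(3)[OF that] Ck_on_has_derivative[OF Suc.prems that]]
    by simp
  have inv: "Ck_on k U (\<lambda>x. inverse (f x))"
    using Suc.IH[OF Ck_on_SucD[OF Suc.prems]] .
  have Ck_der: "Ck_on k U (\<lambda>x. - (inverse (f x) * dir_deriv v f x * inverse (f x)))" for v
    by (rule Ck_on_bounded_linear_compose[OF bounded_linear_minus[OF bounded_linear_ident] assms(1)])
      (intro Ck_on_mult inv assms(1) Ck_on_dir_deriv Suc.prems)
  show ?case by (rule Ck_on_SucI[OF assms(1) d Ck_der])
qed

lemma dir_deriv_expand:
  fixes f :: "'a::euclidean_space \<Rightarrow> 'b::real_normed_vector"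
  assumes "f differentiable (at x)"
  shows "dir_deriv v f x = (\<Sum>b\<in>Basis. (v \<bullet> b) *\<^sub>R dir_deriv b f x)"
proof -
  have "dir_deriv v f x = frechet_derivative f (at x) (\<Sum>b\<in>Basis. (v \<bullet> b) *\<^sub>R b)"
    by (simp add: euclidean_representation)
  also have "\<dots> = (\<Sum>b\<in>Basis. (v \<bullet> b) *\<^sub>R dir_deriv b f x)"
    using linear_frechet_derivative[OF assms] by (simp add: linear_sum linear_cmul)
  finally show ?thesis .
qed

text \<open>The inner derivative is a direction that varies with the base point, whereas \<open>Ck_on\<close> speaks of
  fixed directions. Expanding it in the standard basis separates the two dependences.\<close>

lemma Ck_on_compose:
  fixes f :: "'a::euclidean_space \<Rightarrow> 'b::real_normed_vector"
    and g :: "'c::real_normed_vector \<Rightarrow> 'a"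
  assumes "open W" "g ` W \<subseteq> U" "Ck_on k U f" "Ck_on k W g"
  shows "Ck_on k W (\<lambda>x. f (g x))"
  using assms(3,4)
proof (induction k arbitrary: f)
  case 0
  then show ?case using assms(2) continuous_on_compose2 by fastforce
next
  case (Suc k)
  have d: "((\<lambda>x. f (g x)) has_derivative
      (\<lambda>v. \<Sum>b\<in>Basis. (dir_deriv v g x \<bullet> b) *\<^sub>R dir_deriv b f (g x))) (at x)"
    if "x \<in> W" for x
  proof -
    have gx: "g x \<in> U" using assms(2) that by auto
    have "((\<lambda>x. f (g x)) has_derivative (\<lambda>v. dir_deriv (dir_deriv v g x) f (g x))) (at x)"
      using has_derivative_compose[OF Ck_on_has_derivative[OF Suc.prems(2) that]
          Ck_on_has_derivative[OF Suc.prems(1) gx]] .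
    then show ?thesis
      unfolding dir_deriv_expand[OF Ck_on_differentiable[OF Suc.prems(1) gx], of "dir_deriv _ g x"] .
  qed
  have Ck_der: "Ck_on k W (\<lambda>x. \<Sum>b\<in>Basis. (dir_deriv v g x \<bullet> b) *\<^sub>R dir_deriv b f (g x))" for v
  proof (rule Ck_on_sum[OF assms(1) finite_Basis], rule Ck_on_scaleR[OF assms(1)])
    fix b :: 'a
    show "Ck_on k W (\<lambda>x. dir_deriv v g x \<bullet> b)"
      by (rule Ck_on_bounded_linear_compose[OF bounded_linear_inner_left assms(1)
            Ck_on_dir_deriv[OF Suc.prems(2)]])
    show "Ck_on k W (\<lambda>x. dir_deriv b f (g x))"
      by (rule Suc.IH[OF Ck_on_dir_deriv[OF Suc.prems(1)] Ck_on_SucD[OF Suc.prems(2)]])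
  qed
  show ?case by (rule Ck_on_SucI[OF assms(1) d Ck_der])
qed

text \<open>Linearity in the inner direction is an identity between functions on an open set, so it
  survives the outer differentiation.\<close>

lemma dir_deriv_dir_deriv_linear:
  assumes "open U" "Ck_on 2 U f" "x \<in> U"
  shows "dir_deriv u (dir_deriv (v + w) f) x = dir_deriv u (dir_deriv v f) x + dir_deriv u (dir_deriv w f) x"
    and "dir_deriv u (dir_deriv (c *\<^sub>R v) f) x = c *\<^sub>R dir_deriv u (dir_deriv v f) x"
    and "dir_deriv (v + w) (dir_deriv u f) x = dir_deriv v (dir_deriv u f) x + dir_deriv w (dir_deriv u f) x"
    and "dir_deriv (c *\<^sub>R v) (dir_deriv u f) x = c *\<^sub>R dir_deriv v (dir_deriv u f) x"
proof -
  have C2: "Ck_on (Suc (Suc 0)) U f" using assms(2) by (simp add: numeral_2_eq_2)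
  have d: "f differentiable (at y)" if "y \<in> U" for y
    using Ck_on_differentiable[OF C2 that] .
  have dd: "dir_deriv w f differentiable (at x)" for w
    using Ck_on_differentiable[OF Ck_on_dir_deriv[OF C2] assms(3)] .
  have h: "(dir_deriv w f has_derivative frechet_derivative (dir_deriv w f) (at x)) (at x)" for w
    using dd frechet_derivative_works by blast
  show "dir_deriv u (dir_deriv (v + w) f) x = dir_deriv u (dir_deriv v f) x + dir_deriv u (dir_deriv w f) x"
    using dir_deriv_cong_open[OF assms(1,3) _ dd, of "v + w" "\<lambda>y. dir_deriv v f y + dir_deriv w f y" u]
      linear_dir_deriv(1)[OF d] dir_deriv_eqI[OF has_derivative_add[OF h h]] by metis
  show "dir_deriv u (dir_deriv (c *\<^sub>R v) f) x = c *\<^sub>R dir_deriv u (dir_deriv v f) x"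
    using dir_deriv_cong_open[OF assms(1,3) _ dd, of "c *\<^sub>R v" "\<lambda>y. c *\<^sub>R dir_deriv v f y" u]
      linear_dir_deriv(2)[OF d] dir_deriv_eqI[OF has_derivative_scaleR_right[OF h]] by metis
  show "dir_deriv (v + w) (dir_deriv u f) x = dir_deriv v (dir_deriv u f) x + dir_deriv w (dir_deriv u f) x"
    "dir_deriv (c *\<^sub>R v) (dir_deriv u f) x = c *\<^sub>R dir_deriv v (dir_deriv u f) x"
    using linear_dir_deriv[OF dd] by auto
qed

lemma has_real_derivative_along_line:
  fixes f :: "'a::real_normed_vector \<Rightarrow> real"
  assumes "f differentiable (at (y + t *\<^sub>R v))"
  shows "((\<lambda>t. f (y + t *\<^sub>R v)) has_real_derivative dir_deriv v f (y + t *\<^sub>R v)) (at t)"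
proof -
  have "((\<lambda>t. y + t *\<^sub>R v) has_derivative (\<lambda>h. h *\<^sub>R v)) (at t)"
    by (auto intro!: derivative_eq_intros)
  from has_derivative_compose[OF this] assms
  have "((\<lambda>t. f (y + t *\<^sub>R v)) has_derivative (\<lambda>h. dir_deriv (h *\<^sub>R v) f (y + t *\<^sub>R v))) (at t)"
    using frechet_derivative_works by blast
  then show ?thesis
    unfolding has_field_derivative_def linear_dir_deriv(2)[OF assms] by (simp add: mult_commute_abs)
qed

section \<open>Graphs over tangent spaces and order of contact\<close>

lemma increasing_near_positive_dir_deriv:
  fixes r :: "'a::real_normed_vector \<Rightarrow> real"
  assumes "open U" "p \<in> U" "Ck_on 1 U r" "dir_deriv \<nu> r p = c" "c > 0"
  obtains \<delta> where "\<delta> > 0" "ball p \<delta> \<subseteq> U"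
    "\<And>y s s'. s \<le> s' \<Longrightarrow> y + s *\<^sub>R \<nu> \<in> ball p \<delta> \<Longrightarrow> y + s' *\<^sub>R \<nu> \<in> ball p \<delta> \<Longrightarrow>
        c / 2 * (s' - s) \<le> r (y + s' *\<^sub>R \<nu>) - r (y + s *\<^sub>R \<nu>)"
proof -
  have C1: "Ck_on (Suc 0) U r" using assms(3) by simp
  have "continuous_on U (dir_deriv \<nu> r)" using C1 by simp
  then have "isCont (dir_deriv \<nu> r) p"
    using assms(1,2) continuous_on_eq_continuous_at by blast
  then have "(dir_deriv \<nu> r \<longlongrightarrow> c) (nhds p)"
    using assms(4) tendsto_at_iff_tendsto_nhds[of "dir_deriv \<nu> r" p] by (simp add: isCont_def)
  then have "\<forall>\<^sub>F x in nhds p. dir_deriv \<nu> r x > c / 2"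
    by (rule order_tendstoD(1)) (use assms(5) in simp)
  moreover have "\<forall>\<^sub>F x in nhds p. x \<in> U"
    using assms(1,2) by (rule eventually_nhds_in_open)
  ultimately have "\<forall>\<^sub>F x in nhds p. x \<in> U \<and> dir_deriv \<nu> r x > c / 2"
    by eventually_elim simp
  then obtain \<delta> where \<delta>: "\<delta> > 0" "\<And>x. dist x p < \<delta> \<Longrightarrow> x \<in> U \<and> dir_deriv \<nu> r x > c / 2"
    unfolding eventually_nhds_metric by blast
  show ?thesis
  proof (rule that[OF \<delta>(1)])
    show "ball p \<delta> \<subseteq> U" using \<delta>(2) by (auto simp: dist_commute)
    fix y s s' assume le: "s \<le> s'" and b: "y + s *\<^sub>R \<nu> \<in> ball p \<delta>" "y + s' *\<^sub>R \<nu> \<in> ball p \<delta>"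
    show "c / 2 * (s' - s) \<le> r (y + s' *\<^sub>R \<nu>) - r (y + s *\<^sub>R \<nu>)"
    proof (cases "s = s'")
      case False
      then have lt: "s < s'" using le by simp
      have inb: "y + t *\<^sub>R \<nu> \<in> ball p \<delta>" if "s \<le> t" "t \<le> s'" for t
      proof -
        define u where "u = (t - s) / (s' - s)"
        have u: "0 \<le> u" "u \<le> 1" using that lt by (auto simp: u_def)
        have "(1 - u) * s + u * s' = s + u * (s' - s)" by (simp add: algebra_simps)
        also have "\<dots> = t" using lt by (simp add: u_def)
        finally have t: "t = (1 - u) * s + u * s'" by simp
        have "y + t *\<^sub>R \<nu> = (1 - u) *\<^sub>R (y + s *\<^sub>R \<nu>) + u *\<^sub>R (y + s' *\<^sub>R \<nu>)"
          unfolding t by (simp add: algebra_simps)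
        then show ?thesis
          using convexD[OF convex_ball b, of "1 - u" u] u by simp
      qed
      have "\<exists>z>s. z < s' \<and> r (y + s' *\<^sub>R \<nu>) - r (y + s *\<^sub>R \<nu>) = (s' - s) * dir_deriv \<nu> r (y + z *\<^sub>R \<nu>)"
        using inb \<delta>(2) Ck_on_differentiable[OF C1]
        by (intro MVT2 lt has_real_derivative_along_line) (auto simp: dist_commute)
      then obtain z where z: "s < z" "z < s'"
        "r (y + s' *\<^sub>R \<nu>) - r (y + s *\<^sub>R \<nu>) = (s' - s) * dir_deriv \<nu> r (y + z *\<^sub>R \<nu>)" by blast
      have "dir_deriv \<nu> r (y + z *\<^sub>R \<nu>) > c / 2"
        using \<delta>(2) inb[of z] z by (auto simp: dist_commute)
      then show ?thesis
        unfolding z(3) using lt by (simp add: mult.commute)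
    qed simp
  qed
qed

text \<open>On each normal line near \<open>p\<close> the function \<open>r\<close> is strictly increasing with slope at least \<open>c / 2\<close>,
  so it has exactly one zero there. The same slope bounds the height of that zero by
  \<open>\<bar>r (p + x)\<bar>\<close>, which is \<open>o(\<bar>x\<bar>)\<close> for tangent \<open>x\<close>; this gives tangency of the graph without any
  differentiation of it.\<close>

lemma tangent_graph_of_zero_set:
  fixes r :: "'a::euclidean_space \<Rightarrow> real"
  assumes U: "open U" "p \<in> U" and C1: "Ck_on 1 U r" and r0: "r p = 0"
    and \<nu>: "norm \<nu> = 1" and c: "c > 0" and dr: "\<And>v. dir_deriv v r p = c * (v \<bullet> \<nu>)"
    and S: "\<forall>\<^sub>F q in nhds p. q \<in> S \<longleftrightarrow> r q = 0"
  obtains f where "tangent_graph S p \<nu> f"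
    "\<forall>\<^sub>F x in at 0 within {x. x \<bullet> \<nu> = 0}. r (p + x + f x *\<^sub>R \<nu>) = 0 \<and> \<bar>f x\<bar> \<le> norm x"
proof -
  have \<nu>\<nu>: "\<nu> \<bullet> \<nu> = 1" using \<nu> by (simp add: dot_square_norm)
  have "dir_deriv \<nu> r p = c" using dr \<nu>\<nu> by simp
  then obtain \<delta> where \<delta>: "\<delta> > 0" "ball p \<delta> \<subseteq> U"
    "\<And>y s s'. s \<le> s' \<Longrightarrow> y + s *\<^sub>R \<nu> \<in> ball p \<delta> \<Longrightarrow> y + s' *\<^sub>R \<nu> \<in> ball p \<delta> \<Longrightarrow>
        c / 2 * (s' - s) \<le> r (y + s' *\<^sub>R \<nu>) - r (y + s *\<^sub>R \<nu>)"
    using increasing_near_positive_dir_deriv[OF U C1 _ c] by metis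
  define \<eta> where "\<eta> = \<delta> / 2"
  have \<eta>: "\<eta> > 0" using \<delta>(1) by (simp add: \<eta>_def)
  have inb: "p + x + s *\<^sub>R \<nu> \<in> ball p \<delta>" if "norm x < \<eta>" "\<bar>s\<bar> \<le> \<eta>" for x s
  proof -
    have "norm (x + s *\<^sub>R \<nu>) \<le> norm x + \<bar>s\<bar>"
      using norm_triangle_ineq[of x "s *\<^sub>R \<nu>"] \<nu> by simp
    also have "\<dots> < \<delta>" using that by (simp add: \<eta>_def)
    finally show ?thesis
      using dist_commute[of p "p + x + s *\<^sub>R \<nu>"] by (simp add: dist_norm add.assoc)
  qed
  have slope: "c / 2 * (s' - s) \<le> r (p + x + s' *\<^sub>R \<nu>) - r (p + x + s *\<^sub>R \<nu>)"
    if "norm x < \<eta>" "\<bar>s\<bar> \<le> \<eta>" "\<bar>s'\<bar> \<le> \<eta>" "s \<le> s'" for x s s'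
    using \<delta>(3)[OF that(4) inb[OF that(1,2)] inb[OF that(1,3)]] .
  have "(r has_derivative (\<lambda>v. c * (v \<bullet> \<nu>))) (at p)"
    using Ck_on_has_derivative[of 0 U r p] C1 U ext[of "frechet_derivative r (at p)", OF dr]
    by simp
  then have small: "\<exists>d>0. \<forall>x. norm x < d \<and> x \<bullet> \<nu> = 0 \<longrightarrow> \<bar>r (p + x)\<bar> \<le> e * norm x" if "e > 0" for e
  proof -
    obtain d where "d > 0" and d: "\<And>y. norm (y - p) < d \<Longrightarrow>
        norm (r y - r p - c * ((y - p) \<bullet> \<nu>)) \<le> e * norm (y - p)"
      using \<open>(r has_derivative _) _\<close> \<open>e > 0\<close> unfolding has_derivative_at_alt by metis
    have "\<bar>r (p + x)\<bar> \<le> e * norm x" if "norm x < d" "x \<bullet> \<nu> = 0" for x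
      using d[of "p + x"] that r0 by simp
    then show ?thesis using \<open>d > 0\<close> by blast
  qed
  obtain d where d: "d > 0" "\<And>x. norm x < d \<Longrightarrow> x \<bullet> \<nu> = 0 \<Longrightarrow> \<bar>r (p + x)\<bar> \<le> c / 2 * norm x"
    using small[of "c / 2"] c by auto
  define \<epsilon> where "\<epsilon> = min d \<eta>"
  have \<epsilon>: "\<epsilon> > 0" "\<epsilon> \<le> d" "\<epsilon> \<le> \<eta>" using d(1) \<eta> by (auto simp: \<epsilon>_def)
  have ex: "\<exists>s. \<bar>s\<bar> \<le> \<eta> \<and> r (p + x + s *\<^sub>R \<nu>) = 0" if x: "norm x < \<epsilon>" "x \<bullet> \<nu> = 0" for x
  proof -
    have xe: "norm x < \<eta>" using x \<epsilon> by simp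
    have "\<bar>r (p + x)\<bar> \<le> c / 2 * norm x" using d(2)[of x] x \<epsilon> by simp
    also have "\<dots> \<le> c / 2 * \<eta>" using c xe by simp
    finally have b: "\<bar>r (p + x)\<bar> \<le> c / 2 * \<eta>" .
    have "c / 2 * \<eta> \<le> r (p + x + \<eta> *\<^sub>R \<nu>) - r (p + x)"
      using slope[OF xe, of 0 \<eta>] \<eta> by simp
    then have 1: "r (p + x + \<eta> *\<^sub>R \<nu>) \<ge> 0" using b by linarith
    have "c / 2 * \<eta> \<le> r (p + x) - r (p + x + (- \<eta>) *\<^sub>R \<nu>)"
      using slope[OF xe, of "- \<eta>" 0] \<eta> by simp
    then have 2: "r (p + x + (- \<eta>) *\<^sub>R \<nu>) \<le> 0" using b by linarith
    have "continuous_on {-\<eta>..\<eta>} (\<lambda>s. r (p + x + s *\<^sub>R \<nu>))"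
    proof (rule continuous_on_compose2[OF Ck_on_continuous_on[OF C1]])
      show "continuous_on {-\<eta>..\<eta>} (\<lambda>s. p + x + s *\<^sub>R \<nu>)" by (intro continuous_intros)
      show "(\<lambda>s. p + x + s *\<^sub>R \<nu>) ` {-\<eta>..\<eta>} \<subseteq> U"
        using inb[OF xe] \<delta>(2) by fastforce
    qed
    from IVT'[OF 2 1 _ this] show ?thesis using \<eta> by (force simp: abs_le_iff)
  qed
  define f where "f x = (SOME s. \<bar>s\<bar> \<le> \<eta> \<and> r (p + x + s *\<^sub>R \<nu>) = 0)" for x
  have f: "\<bar>f x\<bar> \<le> \<eta>" "r (p + x + f x *\<^sub>R \<nu>) = 0" if "norm x < \<epsilon>" "x \<bullet> \<nu> = 0" for x
    using someI_ex[OF ex[OF that]] by (auto simp: f_def)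
  have near: "c / 2 * \<bar>s - s'\<bar> \<le> \<bar>r (p + x + s *\<^sub>R \<nu>) - r (p + x + s' *\<^sub>R \<nu>)\<bar>"
    if "norm x < \<epsilon>" "\<bar>s\<bar> \<le> \<eta>" "\<bar>s'\<bar> \<le> \<eta>" for x s s'
    using slope[of x s s'] slope[of x s' s] that \<epsilon> c by (cases "s \<le> s'") (auto simp: abs_if)
  have uniq: "s = f x" if "norm x < \<epsilon>" "x \<bullet> \<nu> = 0" "\<bar>s\<bar> \<le> \<eta>" "r (p + x + s *\<^sub>R \<nu>) = 0" for x s
    using near[of x s "f x"] f[of x] that c
    by (auto simp: mult_le_0_iff)
  have fb: "c / 2 * \<bar>f x\<bar> \<le> \<bar>r (p + x)\<bar>" if "norm x < \<epsilon>" "x \<bullet> \<nu> = 0" for x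
    using near[of x "f x" 0] f[of x] that \<eta> by simp
  have f0: "f 0 = 0" using uniq[of 0 0] r0 \<epsilon> \<eta> by simp
  have "(f has_derivative (\<lambda>_. 0)) (at 0 within {x. x \<bullet> \<nu> = 0})"
    unfolding has_derivative_within_alt
  proof (intro conjI allI impI)
    fix e :: real assume "e > 0"
    then obtain d' where d': "d' > 0"
      "\<And>x. norm x < d' \<Longrightarrow> x \<bullet> \<nu> = 0 \<Longrightarrow> \<bar>r (p + x)\<bar> \<le> (c / 2 * e) * norm x"
      using small[of "c / 2 * e"] c by auto
    have "norm (f y - f 0 - 0) \<le> e * norm (y - 0)"
      if "y \<bullet> \<nu> = 0" "norm (y - 0) < min d' \<epsilon>" for y
    proof -
      have "c / 2 * \<bar>f y\<bar> \<le> c / 2 * (e * norm y)"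
        using fb[of y] d'(2)[of y] that by (simp add: mult.assoc)
      then have "\<bar>f y\<bar> \<le> e * norm y" by (rule mult_left_le_imp_le) (use c in simp)
      then show ?thesis using f0 by simp
    qed
    then show "\<exists>d>0. \<forall>y\<in>{x. x \<bullet> \<nu> = 0}. norm (y - 0) < d \<longrightarrow>
        norm (f y - f 0 - 0) \<le> e * norm (y - 0)"
      using d'(1) \<epsilon>(1) by (intro exI[of _ "min d' \<epsilon>"]) auto
  qed simp
  moreover have "\<forall>\<^sub>F q in nhds p.
        q \<in> S \<longleftrightarrow> (q - p) \<bullet> \<nu> = f (q - p - ((q - p) \<bullet> \<nu>) *\<^sub>R \<nu>)"
  proof -
    have "\<forall>\<^sub>F q in nhds p. dist q p < \<epsilon> / 2"
      unfolding eventually_nhds_metric using \<epsilon>(1) by (intro exI[of _ "\<epsilon> / 2"]) auto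
    with S show ?thesis
    proof eventually_elim
      case (elim q)
      define s where "s = (q - p) \<bullet> \<nu>"
      define x where "x = q - p - s *\<^sub>R \<nu>"
      have q: "q = p + x + s *\<^sub>R \<nu>" by (simp add: x_def)
      have s: "\<bar>s\<bar> \<le> norm (q - p)"
        using Cauchy_Schwarz_ineq2[of "q - p" \<nu>] \<nu> by (simp add: s_def)
      have "norm x \<le> norm (q - p) + \<bar>s\<bar>"
        using norm_triangle_ineq4[of "q - p" "s *\<^sub>R \<nu>"] \<nu> by (simp add: x_def)
      then have x: "norm x < \<epsilon>" using s elim(2) by (simp add: dist_norm)
      have x\<nu>: "x \<bullet> \<nu> = 0" using \<nu>\<nu> by (simp add: x_def s_def inner_diff_left)
      have s\<eta>: "\<bar>s\<bar> \<le> \<eta>" using s elim(2) \<epsilon> by (simp add: dist_norm)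
      have "r q = 0 \<longleftrightarrow> s = f x"
        using uniq[OF x x\<nu> s\<eta>] f(2)[OF x x\<nu>] q by auto
      then show ?case using elim(1) by (simp add: s_def x_def)
    qed
  qed
  ultimately have "tangent_graph S p \<nu> f"
    using \<nu> f0 by (simp add: tangent_graph_def)
  moreover have "\<forall>\<^sub>F x in at 0 within {x. x \<bullet> \<nu> = 0}.
      r (p + x + f x *\<^sub>R \<nu>) = 0 \<and> \<bar>f x\<bar> \<le> norm x"
    unfolding eventually_at
  proof (intro exI[of _ \<epsilon>] conjI ballI impI \<epsilon>(1))
    fix x assume "x \<in> {x. x \<bullet> \<nu> = 0}" "x \<noteq> 0 \<and> dist x 0 < \<epsilon>"
    then have x: "norm x < \<epsilon>" "x \<bullet> \<nu> = 0" by auto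
    show "r (p + x + f x *\<^sub>R \<nu>) = 0" using f(2)[OF x] .
    have "c / 2 * \<bar>f x\<bar> \<le> c / 2 * norm x"
      using fb[OF x] d(2)[of x] x \<epsilon> by simp
    then show "\<bar>f x\<bar> \<le> norm x" by (rule mult_left_le_imp_le) (use c in simp)
  qed
  ultimately show ?thesis using that by blast
qed

text \<open>Evaluating both defining functions on the second graph turns the third-order agreement of
  the defining functions into third-order agreement of the graphs, because \<open>r\<close> grows at least
  linearly in the normal direction. The two functions have the same derivative at \<open>p\<close>, so the two
  graphs can be taken over a common hyperplane.\<close>

lemma contact_order_ge_of_defining_functions:
  fixes r \<rho> :: "'a::euclidean_space \<Rightarrow> real"
  assumes U: "open U" "p \<in> U" and C1: "Ck_on 1 U r" "Ck_on 1 U \<rho>"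
    and r0: "r p = 0" and dr: "dir_deriv v\<^sub>0 r p \<noteq> 0"
    and S: "\<forall>\<^sub>F q in nhds p. q \<in> S \<longleftrightarrow> r q = 0" and T: "\<forall>\<^sub>F q in nhds p. q \<in> T \<longleftrightarrow> \<rho> q = 0"
    and K: "\<forall>\<^sub>F q in nhds p. \<bar>r q - \<rho> q\<bar> \<le> K * norm (q - p) ^ 3"
  shows "contact_order_ge 3 S T p"
proof -
  have \<rho>0: "\<rho> p = 0" using eventually_nhds_x_imp_x[OF K] r0 by simp
  have hr: "(r has_derivative frechet_derivative r (at p)) (at p)"
    and h\<rho>: "(\<rho> has_derivative frechet_derivative \<rho> (at p)) (at p)"
    using Ck_on_has_derivative[of 0 U _ p] C1 U by auto
  define w where "w = adjoint (frechet_derivative r (at p)) 1"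
  have drw: "dir_deriv v r p = v \<bullet> w" for v
    using adjoint_works[OF has_derivative_linear[OF hr], of v 1] by (simp add: w_def)
  have w0: "w \<noteq> 0" using dr drw by auto
  define c where "c = norm w"
  define \<nu> where "\<nu> = (1 / c) *\<^sub>R w"
  have c: "c > 0" using w0 by (simp add: c_def)
  have \<nu>: "norm \<nu> = 1" using c by (simp add: \<nu>_def c_def)
  have dr\<nu>: "dir_deriv v r p = c * (v \<bullet> \<nu>)" for v
    using c by (simp add: drw \<nu>_def)
  obtain d where d: "d > 0" "\<And>q. dist q p < d \<Longrightarrow> \<bar>r q - \<rho> q\<bar> \<le> K * norm (q - p) ^ 3"
    using K unfolding eventually_nhds_metric by blast
  have "((\<lambda>q. r q - \<rho> q) has_derivative (\<lambda>_. 0)) (at p)"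
    unfolding has_derivative_at_alt
  proof (intro conjI allI impI)
    fix e :: real assume e: "e > 0"
    define d' where "d' = min (min d 1) (e / (\<bar>K\<bar> + 1))"
    have d': "d' > 0" "d' \<le> d" "d' \<le> 1" "d' \<le> e / (\<bar>K\<bar> + 1)" using d(1) e by (auto simp: d'_def)
    have "norm (r y - \<rho> y - (r p - \<rho> p) - 0) \<le> e * norm (y - p)" if y: "norm (y - p) < d'" for y
    proof -
      have n: "norm (y - p) \<le> 1" "norm (y - p) \<le> e / (\<bar>K\<bar> + 1)" using y d' by auto
      have "\<bar>r y - \<rho> y\<bar> \<le> K * norm (y - p) ^ 3" using d(2)[of y] y d' by (simp add: dist_norm)
      also have "\<dots> \<le> (\<bar>K\<bar> + 1) * norm (y - p) ^ 3" by (intro mult_right_mono) auto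
      also have "\<dots> = (\<bar>K\<bar> + 1) * norm (y - p) * norm (y - p) * norm (y - p)"
        by (simp add: power3_eq_cube)
      also have "\<dots> \<le> (\<bar>K\<bar> + 1) * norm (y - p) * 1 * norm (y - p)"
        using n by (intro mult_mono) auto
      also have "\<dots> \<le> e * norm (y - p)"
        using n(2) by (intro mult_right_mono) (auto simp: field_simps)
      finally show ?thesis using r0 \<rho>0 by simp
    qed
    then show "\<exists>d>0. \<forall>y. norm (y - p) < d \<longrightarrow>
        norm (r y - \<rho> y - (r p - \<rho> p) - 0) \<le> e * norm (y - p)"
      using d'(1) by blast
  qed simp
  then have "(\<lambda>v. dir_deriv v r p - dir_deriv v \<rho> p) = (\<lambda>_. 0)"
    using has_derivative_unique[OF has_derivative_diff[OF hr h\<rho>]] by simp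
  then have d\<rho>\<nu>: "dir_deriv v \<rho> p = c * (v \<bullet> \<nu>)" for v
    using dr\<nu>[of v] by (metis right_minus_eq)
  obtain f where f: "tangent_graph S p \<nu> f"
    "\<forall>\<^sub>F x in at 0 within {x. x \<bullet> \<nu> = 0}. r (p + x + f x *\<^sub>R \<nu>) = 0 \<and> \<bar>f x\<bar> \<le> norm x"
    using tangent_graph_of_zero_set[OF U C1(1) r0 \<nu> c dr\<nu> S] by blast
  obtain g where g: "tangent_graph T p \<nu> g"
    "\<forall>\<^sub>F x in at 0 within {x. x \<bullet> \<nu> = 0}. \<rho> (p + x + g x *\<^sub>R \<nu>) = 0 \<and> \<bar>g x\<bar> \<le> norm x"
    using tangent_graph_of_zero_set[OF U C1(2) \<rho>0 \<nu> c d\<rho>\<nu> T] by blast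
  have "\<nu> \<bullet> \<nu> = 1" using \<nu> by (simp add: dot_square_norm)
  then have "dir_deriv \<nu> r p = c" using dr\<nu> by simp
  then obtain \<delta> where \<delta>: "\<delta> > 0" "ball p \<delta> \<subseteq> U"
    "\<And>y s s'. s \<le> s' \<Longrightarrow> y + s *\<^sub>R \<nu> \<in> ball p \<delta> \<Longrightarrow> y + s' *\<^sub>R \<nu> \<in> ball p \<delta> \<Longrightarrow>
        c / 2 * (s' - s) \<le> r (y + s' *\<^sub>R \<nu>) - r (y + s *\<^sub>R \<nu>)"
    using increasing_near_positive_dir_deriv[OF U C1(1) _ c] by metis
  have "\<forall>\<^sub>F x in at 0 within {x. x \<bullet> \<nu> = 0}. norm x < min \<delta> d / 2"
    unfolding eventually_at using \<delta>(1) d(1) by (intro exI[of _ "min \<delta> d / 2"]) auto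
  with f(2) g(2)
  have "\<forall>\<^sub>F x in at 0 within {x. x \<bullet> \<nu> = 0}.
      norm (f x - g x) \<le> (2 / c * \<bar>K\<bar> * 8) * norm (norm x ^ 3)"
  proof eventually_elim
    case (elim x)
    have nb: "norm (x + s *\<^sub>R \<nu>) \<le> 2 * norm x" if "\<bar>s\<bar> \<le> norm x" for s
      using norm_triangle_ineq[of x "s *\<^sub>R \<nu>"] \<nu> that by simp
    have inb: "p + x + s *\<^sub>R \<nu> \<in> ball p \<delta>" if "\<bar>s\<bar> \<le> norm x" for s
      using nb[OF that] elim(3) dist_commute[of p "p + x + s *\<^sub>R \<nu>"]
      by (simp add: dist_norm add.assoc)
    have "c / 2 * \<bar>f x - g x\<bar> \<le> \<bar>r (p + x + f x *\<^sub>R \<nu>) - r (p + x + g x *\<^sub>R \<nu>)\<bar>"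
      using \<delta>(3)[of "f x" "g x" "p + x"] \<delta>(3)[of "g x" "f x" "p + x"] inb elim c
      by (cases "f x \<le> g x") (auto simp: abs_if)
    also have "\<dots> = \<bar>r (p + x + g x *\<^sub>R \<nu>) - \<rho> (p + x + g x *\<^sub>R \<nu>)\<bar>" using elim by simp
    also have "\<dots> \<le> K * norm (x + g x *\<^sub>R \<nu>) ^ 3"
    proof -
      have e: "p + x + g x *\<^sub>R \<nu> - p = x + g x *\<^sub>R \<nu>" by simp
      show ?thesis
        using d(2)[of "p + x + g x *\<^sub>R \<nu>"] nb[of "g x"] elim unfolding dist_norm e by simp
    qed
    also have "\<dots> \<le> \<bar>K\<bar> * (2 * norm x) ^ 3"
      using nb[of "g x"] elim by (intro mult_mono power_mono) auto
    also have "\<dots> = c / 2 * ((2 / c * \<bar>K\<bar> * 8) * norm x ^ 3)"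
      using c by (simp add: power_mult_distrib)
    finally have "\<bar>f x - g x\<bar> \<le> (2 / c * \<bar>K\<bar> * 8) * norm x ^ 3"
      by (rule mult_left_le_imp_le) (use c in simp)
    then show ?case by simp
  qed
  then have "(\<lambda>x. f x - g x) \<in> O[at 0 within {x. x \<bullet> \<nu> = 0}](\<lambda>x. norm x ^ 3)"
    by (rule bigoI)
  then show ?thesis using f(1) g(1) unfolding contact_order_ge_def by blast
qed

section \<open>Second-order Taylor expansion\<close>

text \<open>Written in a basis, the third derivative along \<open>w\<close> is visibly bounded by a constant times
  \<open>\<bar>w\<bar>\<^sup>3\<close>, locally uniformly in the base point; this is what the Taylor remainder needs.\<close>

lemma dir_deriv3_expand:
  fixes f :: "'a::euclidean_space \<Rightarrow> real"
  assumes U: "open U" "x \<in> U" and C3: "Ck_on 3 U f"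
  shows "dir_deriv w (dir_deriv w (dir_deriv w f)) x =
    (\<Sum>a\<in>Basis. \<Sum>b\<in>Basis. \<Sum>c\<in>Basis.
       (w \<bullet> a) * ((w \<bullet> b) * ((w \<bullet> c) * dir_deriv c (dir_deriv b (dir_deriv a f)) x)))"
proof -
  have C: "Ck_on (Suc (Suc (Suc 0))) U f" using C3 by (simp add: numeral_3_eq_3)
  have d0: "f differentiable (at y)" if "y \<in> U" for y
    using Ck_on_differentiable[OF C that] .
  have d1: "dir_deriv v f differentiable (at y)" if "y \<in> U" for v y
    using Ck_on_differentiable[OF Ck_on_dir_deriv[OF C] that] .
  have d2: "dir_deriv u (dir_deriv v f) differentiable (at y)" if "y \<in> U" for u v y
    using Ck_on_differentiable[OF Ck_on_dir_deriv[OF Ck_on_dir_deriv[OF C]] that] .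
  have s: "dir_deriv v (\<lambda>y. \<Sum>a\<in>Basis. (w \<bullet> a) * g a y) y
      = (\<Sum>a\<in>Basis. (w \<bullet> a) * dir_deriv v (g a) y)"
    if "\<And>a. g a differentiable (at y)" for g :: "'a \<Rightarrow> 'a \<Rightarrow> real" and v y
    by (rule dir_deriv_eqI, rule has_derivative_sum, rule has_derivative_mult_right)
      (use that frechet_derivative_works in blast)
  have e0: "dir_deriv w g y = (\<Sum>b\<in>Basis. (w \<bullet> b) * dir_deriv b g y)"
    if "g differentiable (at y)" for g :: "'a \<Rightarrow> real" and y
    using dir_deriv_expand[OF that, of w] by simp
  have e1: "dir_deriv w f y = (\<Sum>a\<in>Basis. (w \<bullet> a) * dir_deriv a f y)" if "y \<in> U" for y
    using dir_deriv_expand[OF d0[OF that], of w] by simp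
  have e2: "dir_deriv w (dir_deriv w f) y =
      (\<Sum>a\<in>Basis. \<Sum>b\<in>Basis. (w \<bullet> a) * ((w \<bullet> b) * dir_deriv b (dir_deriv a f) y))"
    if y: "y \<in> U" for y
  proof -
    have "dir_deriv w (dir_deriv w f) y = (\<Sum>a\<in>Basis. (w \<bullet> a) * dir_deriv w (dir_deriv a f) y)"
      using dir_deriv_cong_open[OF U(1) y e1 d1[OF y], of w] s[OF d1[OF y]] by simp
    also have "\<dots> = (\<Sum>a\<in>Basis. (w \<bullet> a) * (\<Sum>b\<in>Basis. (w \<bullet> b) * dir_deriv b (dir_deriv a f) y))"
      by (simp only: e0[OF d1[OF y]])
    finally show ?thesis by (simp add: sum_distrib_left)
  qed
  have "dir_deriv w (dir_deriv w (dir_deriv w f)) x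
      = dir_deriv w (\<lambda>y. \<Sum>a\<in>Basis. (w \<bullet> a) * (\<Sum>b\<in>Basis. (w \<bullet> b) * dir_deriv b (dir_deriv a f) y)) x"
    by (rule dir_deriv_cong_open[OF U _ d2[OF U(2)]]) (simp add: e2 sum_distrib_left)
  also have "\<dots> = (\<Sum>a\<in>Basis. (w \<bullet> a) *
      dir_deriv w (\<lambda>y. \<Sum>b\<in>Basis. (w \<bullet> b) * dir_deriv b (dir_deriv a f) y) x)"
    by (rule s) (intro differentiable_sum ballI differentiable_mult differentiable_const d2 U(2) finite_Basis)
  also have "\<dots> = (\<Sum>a\<in>Basis. (w \<bullet> a) *
      (\<Sum>b\<in>Basis. (w \<bullet> b) * dir_deriv w (dir_deriv b (dir_deriv a f)) x))"
    using s[OF d2[OF U(2)]] by simp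
  also have "\<dots> = (\<Sum>a\<in>Basis. (w \<bullet> a) * (\<Sum>b\<in>Basis. (w \<bullet> b) *
      (\<Sum>c\<in>Basis. (w \<bullet> c) * dir_deriv c (dir_deriv b (dir_deriv a f)) x)))"
    by (simp only: e0[OF d2[OF U(2)]])
  finally show ?thesis by (simp add: sum_distrib_left)
qed

lemma Taylor_order_2:
  fixes f :: "'a::euclidean_space \<Rightarrow> real"
  assumes U: "open U" "p \<in> U" and C3: "Ck_on 3 U f"
  obtains K where "\<forall>\<^sub>F q in nhds p.
    \<bar>f q - f p - dir_deriv (q - p) f p - dir_deriv (q - p) (dir_deriv (q - p) f) p / 2\<bar>
      \<le> K * norm (q - p) ^ 3"
proof -
  have C: "Ck_on (Suc (Suc (Suc 0))) U f" using C3 by (simp add: numeral_3_eq_3)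
  obtain d where d: "d > 0" "cball p d \<subseteq> U" using U open_contains_cball by blast
  have bd: "\<exists>B\<ge>0. \<forall>x\<in>cball p d. \<bar>dir_deriv u (dir_deriv v (dir_deriv w f)) x\<bar> \<le> B" for u v w
  proof -
    have "continuous_on (cball p d) (dir_deriv u (dir_deriv v (dir_deriv w f)))"
      using continuous_on_subset[OF Ck_on_continuous_on[OF
            Ck_on_dir_deriv[OF Ck_on_dir_deriv[OF Ck_on_dir_deriv[OF C]]]] d(2)] .
    then have "bounded (dir_deriv u (dir_deriv v (dir_deriv w f)) ` cball p d)"
      using compact_continuous_image compact_cball compact_imp_bounded by blast
    then show ?thesis unfolding bounded_pos by (auto intro: less_imp_le)
  qed
  define B where "B u v w = (SOME B. B \<ge> 0 \<and>
      (\<forall>x\<in>cball p d. \<bar>dir_deriv u (dir_deriv v (dir_deriv w f)) x\<bar> \<le> B))" for u v w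
  have "B u v w \<ge> 0 \<and>
      (\<forall>x\<in>cball p d. \<bar>dir_deriv u (dir_deriv v (dir_deriv w f)) x\<bar> \<le> B u v w)" for u v w
    using someI_ex[OF bd[where u = u and v = v and w = w]] unfolding B_def .
  then have B: "B u v w \<ge> 0"
    "x \<in> cball p d \<Longrightarrow> \<bar>dir_deriv u (dir_deriv v (dir_deriv w f)) x\<bar> \<le> B u v w" for u v w x
    by blast+
  define K where "K = (\<Sum>a\<in>Basis. \<Sum>b\<in>Basis. \<Sum>c\<in>Basis. B c b (a::'a))"
  have third: "\<bar>dir_deriv w (dir_deriv w (dir_deriv w f)) x\<bar> \<le> K * norm w ^ 3"
    if x: "x \<in> cball p d" for w x
  proof -
    have "\<bar>dir_deriv w (dir_deriv w (dir_deriv w f)) x\<bar> \<le>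
      (\<Sum>a\<in>Basis. \<Sum>b\<in>Basis. \<Sum>c\<in>Basis. B c b a * norm w ^ 3)"
      unfolding dir_deriv3_expand[OF U(1) subsetD[OF d(2) x] C3, of w]
    proof (intro order_trans[OF sum_abs] sum_mono)
      fix a b c :: 'a assume abc: "a \<in> Basis" "b \<in> Basis" "c \<in> Basis"
      have "\<bar>(w \<bullet> a) * ((w \<bullet> b) * ((w \<bullet> c) * dir_deriv c (dir_deriv b (dir_deriv a f)) x))\<bar>
        = \<bar>w \<bullet> a\<bar> * (\<bar>w \<bullet> b\<bar> * (\<bar>w \<bullet> c\<bar> * \<bar>dir_deriv c (dir_deriv b (dir_deriv a f)) x\<bar>))"
        by (simp add: abs_mult)
      also have "\<dots> \<le> norm w * (norm w * (norm w * B c b a))"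
        using Basis_le_norm abc B x by (intro mult_mono) auto
      finally show "\<bar>(w \<bullet> a) * ((w \<bullet> b) * ((w \<bullet> c) * dir_deriv c (dir_deriv b (dir_deriv a f)) x))\<bar>
        \<le> B c b a * norm w ^ 3" by (simp add: power3_eq_cube mult_ac)
    qed
    also have "\<dots> = K * norm w ^ 3" by (simp add: K_def sum_distrib_right)
    finally show ?thesis .
  qed
  have "\<bar>f q - f p - dir_deriv (q - p) f p - dir_deriv (q - p) (dir_deriv (q - p) f) p / 2\<bar>
      \<le> (K / 6) * norm (q - p) ^ 3" if q: "dist q p < d" for q
  proof -
    define w where "w = q - p"
    define D where "D m = ((dir_deriv w) ^^ m) f" for m :: nat
    have D: "D 0 = f" "D (Suc 0) = dir_deriv w f" "D 2 = dir_deriv w (dir_deriv w f)"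
      "D 3 = dir_deriv w (dir_deriv w (dir_deriv w f))"
      by (auto simp: D_def numeral_2_eq_2 numeral_3_eq_3)
    have inb: "p + t *\<^sub>R w \<in> cball p d" if "0 \<le> t" "t \<le> 1" for t
    proof -
      have "\<bar>t\<bar> * norm w \<le> 1 * norm w" using that by (intro mult_right_mono) auto
      then show ?thesis using q by (simp add: w_def dist_norm norm_minus_commute)
    qed
    have diff: "D m differentiable (at y)" if "m < 3" "y \<in> U" for m y
    proof -
      consider "m = 0" | "m = Suc 0" | "m = 2" using \<open>m < 3\<close> by linarith
      then show ?thesis
      proof cases
        case 1
        show ?thesis unfolding 1 D using Ck_on_differentiable[OF C that(2)] .
      next
        case 2
        show ?thesis unfolding 2 D using Ck_on_differentiable[OF Ck_on_dir_deriv[OF C] that(2)] .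
      next
        case 3
        show ?thesis unfolding 3 D
          using Ck_on_differentiable[OF Ck_on_dir_deriv[OF Ck_on_dir_deriv[OF C]] that(2)] .
      qed
    qed
    have "\<forall>m t. m < 3 \<and> 0 \<le> t \<and> t \<le> 1 \<longrightarrow>
        DERIV (\<lambda>t. D m (p + t *\<^sub>R w)) t :> D (Suc m) (p + t *\<^sub>R w)"
    proof (intro allI impI)
      fix m :: nat and t :: real assume a: "m < 3 \<and> 0 \<le> t \<and> t \<le> 1"
      show "DERIV (\<lambda>t. D m (p + t *\<^sub>R w)) t :> D (Suc m) (p + t *\<^sub>R w)"
        using has_real_derivative_along_line[OF diff[of m "p + t *\<^sub>R w"]] a inb[of t] d(2)
        by (auto simp: D_def)
    qed
    from Maclaurin[of 1 3 "\<lambda>m t. D m (p + t *\<^sub>R w)" "\<lambda>t. f (p + t *\<^sub>R w)", OF _ _ _ this]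
    obtain t where t: "0 < t" "t < 1"
      "f (p + w) = (\<Sum>m<3. D m p / fact m) + D 3 (p + t *\<^sub>R w) / fact 3"
      by (auto simp: D)
    have E: "f q - f p - dir_deriv w f p - dir_deriv w (dir_deriv w f) p / 2 = D 3 (p + t *\<^sub>R w) / 6"
    proof -
      have "(\<Sum>m<3. D m p / fact m) = D 0 p + D (Suc 0) p + D 2 p / 2"
        by (simp add: numeral_3_eq_3 numeral_2_eq_2)
      moreover have "fact 3 = (6 :: real)" by (simp add: fact_numeral)
      ultimately show ?thesis using t(3) D(1-3) by (simp add: w_def)
    qed
    have "\<bar>D 3 (p + t *\<^sub>R w)\<bar> \<le> K * norm w ^ 3"
      unfolding D using third[OF inb] t by simp
    then show ?thesis unfolding w_def[symmetric] E by simp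
  qed
  then have "\<forall>\<^sub>F q in nhds p.
    \<bar>f q - f p - dir_deriv (q - p) f p - dir_deriv (q - p) (dir_deriv (q - p) f) p / 2\<bar>
      \<le> (K / 6) * norm (q - p) ^ 3"
    unfolding eventually_nhds_metric using d(1) by blast
  then show ?thesis by (rule that)
qed

section \<open>Complex scalars acting on real derivatives\<close>

lemma scaleR_eq_vector_smult: "c *\<^sub>R (z :: complex^'n) = of_real c *s z"
  by (simp add: vec_eq_iff) (simp add: scaleR_conv_of_real)

lemma norm_vector_smult_complex: "norm (a *s (z :: complex^'n)) = cmod a * norm z"
  by (simp add: norm_vec_def norm_mult L2_set_right_distrib)

lemma bounded_bilinear_vector_smult: "bounded_bilinear (\<lambda>a (z :: complex^'n). a *s z)"
proof
  show "\<exists>K. \<forall>a (z :: complex^'n). norm (a *s z) \<le> norm a * norm z * K"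
    by (intro exI[of _ 1]) (simp add: norm_vector_smult_complex)
qed (auto simp: vec_eq_iff algebra_simps)

lemmas bounded_linear_vector_smult =
  bounded_bilinear.bounded_linear_right[OF bounded_bilinear_vector_smult]

lemmas bounded_linear_vector_smult_left =
  bounded_bilinear.bounded_linear_left[OF bounded_bilinear_vector_smult]

lemmas continuous_on_vector_smult =
  bounded_bilinear.continuous_on[OF bounded_bilinear_vector_smult]

lemma vec_complex_decompose:
  "(w :: complex^'n) = (\<Sum>j\<in>UNIV. Re (w $ j) *\<^sub>R axis j 1 + Im (w $ j) *\<^sub>R axis j \<i>)"
proof (rule vec_eq_iff[THEN iffD2], rule allI)
  fix i
  have "(\<Sum>j\<in>UNIV. Re (w $ j) *\<^sub>R axis j 1 + Im (w $ j) *\<^sub>R axis j \<i> :: complex^'n) $ i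
      = (\<Sum>j\<in>UNIV. if j = i then w $ i else 0)"
    unfolding sum_component
    by (rule sum.cong) (auto simp: axis_def complex_eq_iff)
  also have "\<dots> = w $ i" by simp
  finally show "w $ i = (\<Sum>j\<in>UNIV. Re (w $ j) *\<^sub>R axis j 1 + Im (w $ j) *\<^sub>R axis j \<i>) $ i" ..
qed

lemma linear_vec_complex_expand:
  fixes L :: "complex^'n \<Rightarrow> real"
  assumes "linear L"
  shows "L w = (\<Sum>j\<in>UNIV. Re (w $ j) * L (axis j 1) + Im (w $ j) * L (axis j \<i>))"
proof -
  have "L w = L (\<Sum>j\<in>UNIV. Re (w $ j) *\<^sub>R axis j 1 + Im (w $ j) *\<^sub>R axis j \<i>)"
    by (rule arg_cong[OF vec_complex_decompose])
  then show ?thesis by (simp add: linear_sum[OF assms] linear_add[OF assms] linear_cmul[OF assms])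
qed

text \<open>Averaging a real second derivative over \<open>w\<close> and \<open>\<i> w\<close> kills its \<open>(2,0)\<close> part and leaves
  the Levi form.\<close>

lemma levi_positive_at_real:
  fixes r :: "complex^'n \<Rightarrow> real"
  assumes U: "open U" "p \<in> U" and C2: "Ck_on 2 U r" and levi: "levi_positive_at r p"
    and w: "w \<noteq> 0" "dir_deriv w r p = 0" "dir_deriv (\<i> *s w) r p = 0"
  shows "dir_deriv w (dir_deriv w r) p + dir_deriv (\<i> *s w) (dir_deriv (\<i> *s w) r) p > 0"
proof -
  define \<rho> where "\<rho> z = complex_of_real (r z)" for z
  have C: "Ck_on (Suc (Suc 0)) U r" using C2 by (simp add: numeral_2_eq_2)
  have h: "(r has_derivative frechet_derivative r (at z)) (at z)" if "z \<in> U" for z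
    using Ck_on_has_derivative[OF C that] .
  have hh: "(dir_deriv v r has_derivative frechet_derivative (dir_deriv v r) (at p)) (at p)" for v
    using Ck_on_has_derivative[OF Ck_on_dir_deriv[OF C] U(2)] .
  have d\<rho>: "dir_deriv v \<rho> z = of_real (dir_deriv v r z)" if "z \<in> U" for v z
    unfolding \<rho>_def by (rule dir_deriv_eqI) (rule has_derivative_of_real[OF h[OF that]])
  define W where "W j z = (of_real (dir_deriv (axis j 1) r z)
      - \<i> * of_real (dir_deriv (axis j \<i>) r z)) / 2" for j z
  have wirt: "wirtinger j \<rho> z = W j z" if "z \<in> U" for j z
    by (simp add: wirtinger_def W_def d\<rho>[OF that])
  define b where "b u v = dir_deriv u (dir_deriv v r) p" for u v
  have hW: "(W j has_derivative (\<lambda>v. (of_real (b v (axis j 1)) - \<i> * of_real (b v (axis j \<i>))) / 2))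
      (at p)" for j
    unfolding W_def b_def
    by (rule has_derivative_divide[where g' = "\<lambda>_. 0", THEN has_derivative_eq_rhs]
        derivative_intros hh | simp)+
  have "(wirtinger j \<rho> has_derivative
      (\<lambda>v. (of_real (b v (axis j 1)) - \<i> * of_real (b v (axis j \<i>))) / 2)) (at p)" for j
    by (rule has_derivative_transform_within_open[OF hW U]) (simp add: wirt)
  then have dW: "dir_deriv v (wirtinger j \<rho>) p
      = (of_real (b v (axis j 1)) - \<i> * of_real (b v (axis j \<i>))) / 2" for v j
    by (rule dir_deriv_eqI)
  have lin: "linear (\<lambda>v. dir_deriv v r p)"
    using linear_frechet_derivative[OF Ck_on_differentiable[OF C U(2)]] .
  have "(\<Sum>j\<in>UNIV. wirtinger j \<rho> p * w $ j) =
      (of_real (dir_deriv w r p) - \<i> * of_real (dir_deriv (\<i> *s w) r p)) / 2"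
    unfolding linear_vec_complex_expand[OF lin, of w] linear_vec_complex_expand[OF lin, of "\<i> *s w"]
      wirt[OF U(2)] W_def of_real_sum sum_distrib_left sum_subtractf[symmetric] sum_divide_distrib
    by (intro sum.cong refl) (simp add: complex_eq_iff algebra_simps)
  then have tang: "(\<Sum>j\<in>UNIV. wirtinger j \<rho> p * w $ j) = 0" using w by simp
  have lin1: "linear (\<lambda>u. b u v)" for v
    unfolding b_def
    using linear_frechet_derivative[OF Ck_on_differentiable[OF Ck_on_dir_deriv[OF C] U(2)]] .
  have lin2: "linear (\<lambda>v. b u v)" for u
    unfolding b_def using dir_deriv_dir_deriv_linear[OF U(1) C2 U(2)] by (intro linearI) auto
  have bexp: "b v v = (\<Sum>j\<in>UNIV. \<Sum>k\<in>UNIV.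
      Re (v $ j) * Re (v $ k) * b (axis k 1) (axis j 1)
      + Re (v $ j) * Im (v $ k) * b (axis k \<i>) (axis j 1)
      + Im (v $ j) * Re (v $ k) * b (axis k 1) (axis j \<i>)
      + Im (v $ j) * Im (v $ k) * b (axis k \<i>) (axis j \<i>))" for v
    unfolding linear_vec_complex_expand[OF lin2[of v], of v]
  proof (rule sum.cong[OF refl])
    fix j
    have e: "b v x = (\<Sum>k\<in>UNIV. Re (v $ k) * b (axis k 1) x + Im (v $ k) * b (axis k \<i>) x)" for x
      by (rule linear_vec_complex_expand[OF lin1])
    show "Re (v $ j) * b v (axis j 1) + Im (v $ j) * b v (axis j \<i>) = (\<Sum>k\<in>UNIV.
      Re (v $ j) * Re (v $ k) * b (axis k 1) (axis j 1)
      + Re (v $ j) * Im (v $ k) * b (axis k \<i>) (axis j 1)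
      + Im (v $ j) * Re (v $ k) * b (axis k 1) (axis j \<i>)
      + Im (v $ j) * Im (v $ k) * b (axis k \<i>) (axis j \<i>))"
      unfolding e[of "axis j 1"] e[of "axis j \<i>"] sum_distrib_left sum.distrib[symmetric]
      by (intro sum.cong refl) (simp add: algebra_simps)
  qed
  have "Re (\<Sum>j\<in>UNIV. \<Sum>k\<in>UNIV. wirtinger_bar k (wirtinger j \<rho>) p * w $ j * cnj (w $ k))
      = (b w w + b (\<i> *s w) (\<i> *s w)) / 4"
    unfolding bexp Re_sum sum.distrib[symmetric] sum_divide_distrib wirtinger_bar_def dW
    by (intro sum.cong refl) (simp add: algebra_simps add_divide_distrib diff_divide_distrib)
  moreover have "Re (\<Sum>j\<in>UNIV. \<Sum>k\<in>UNIV.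
      wirtinger_bar k (wirtinger j \<rho>) p * w $ j * cnj (w $ k)) > 0"
    using levi w(1) tang unfolding levi_positive_at_def Let_def \<rho>_def by blast
  ultimately show ?thesis by (simp add: b_def)
qed

section \<open>The gauge of a complete circular domain\<close>

text \<open>The implicit function theorem at a single point for a function of a special shape: the equation
  \<open>r (z / N z) = 0\<close> determines the derivative of \<open>N\<close> as soon as \<open>N\<close> is continuous.\<close>

lemma has_derivative_radial_function:
  fixes N :: "'a::real_normed_vector \<Rightarrow> real"
  assumes N: "isCont N y" "N y = 1" and r: "(r has_derivative D) (at y)" "r y = 0"
    and k: "D y = k" "k > 0" and S: "\<forall>\<^sub>F z in nhds y. r ((1 / N z) *\<^sub>R z) = 0"
  shows "(N has_derivative (\<lambda>v. D v / k)) (at y)"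
  unfolding has_derivative_at_alt
proof (intro conjI allI impI)
  have bl: "bounded_linear D" using has_derivative_bounded_linear[OF r(1)] .
  interpret D: bounded_linear D by (rule bl)
  show "bounded_linear (\<lambda>v. D v / k)" by (rule bounded_linear_compose[OF bounded_linear_divide bl])
  fix e :: real assume e: "e > 0"
  obtain M where M: "M > 0" "\<And>v. \<bar>D v\<bar> \<le> M * norm v"
    using D.pos_bounded by (auto simp: mult.commute)
  \<comment> \<open>\<open>C\<close> is the Lipschitz constant of \<open>N\<close> at \<open>y\<close> that comes out of the first estimate; \<open>\<eta>\<close> is the
    linearisation error of \<open>r\<close>, small enough first to absorb the increment \<open>\<delta>\<close> of \<open>N\<close> and then to
    leave \<open>e\<close>.\<close>
  define C where "C = 2 * (M + 1) / k"
  have C: "C > 0" using M k by (simp add: C_def)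
  define \<eta> where "\<eta> = min (min 1 (k / (2 * (norm y + 1)))) (e * k / (1 + C * norm y))"
  have pos: "1 + C * norm y > 0" using C by (simp add: add_pos_nonneg)
  have \<eta>: "\<eta> > 0" "\<eta> \<le> 1" "\<eta> \<le> k / (2 * (norm y + 1))" "\<eta> \<le> e * k / (1 + C * norm y)"
    using e k pos unfolding \<eta>_def
    by (auto intro!: divide_pos_pos mult_pos_pos add_nonneg_pos)
  have \<eta>2: "\<eta> * norm y \<le> k / 2"
  proof -
    have "\<eta> * norm y \<le> k / (2 * (norm y + 1)) * (norm y + 1)"
      using \<eta> k by (intro mult_mono) auto
    also have "\<dots> = k / 2"
    proof -
      have "norm y + 1 \<noteq> 0" using norm_ge_zero[of y] by linarith
      then show ?thesis by (simp add: divide_simps)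
    qed
    finally show ?thesis .
  qed
  have \<eta>3: "\<eta> * (1 + C * norm y) \<le> e * k"
    using \<eta>(4) pos by (simp add: pos_le_divide_eq)
  obtain d where d: "d > 0" "\<And>x. norm (x - y) < d \<Longrightarrow> norm (r x - r y - D (x - y)) \<le> \<eta> * norm (x - y)"
    using r(1) \<eta>(1) unfolding has_derivative_at_alt by metis
  have "((\<lambda>z. (1 / N z) *\<^sub>R z) \<longlongrightarrow> (1 / N y) *\<^sub>R y) (at y)"
    using N by (intro tendsto_intros) (auto simp: isCont_def)
  then have "((\<lambda>z. (1 / N z) *\<^sub>R z) \<longlongrightarrow> (1 / N y) *\<^sub>R y) (nhds y)"
    using tendsto_at_iff_tendsto_nhds[of "\<lambda>z. (1 / N z) *\<^sub>R z" y] by simp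
  then have ev1: "\<forall>\<^sub>F z in nhds y. dist ((1 / N z) *\<^sub>R z) y < d"
    using N(2) d(1) by (auto dest!: tendstoD)
  have "(N \<longlongrightarrow> N y) (nhds y)"
    using N(1) tendsto_at_iff_tendsto_nhds[of N y] by (simp add: isCont_def)
  then have "\<forall>\<^sub>F z in nhds y. N z > 0" by (rule order_tendstoD) (use N in simp)
  with S ev1 have "\<forall>\<^sub>F z in nhds y. norm (N z - N y - D (z - y) / k) \<le> e * norm (z - y)"
  proof eventually_elim
    case (elim z)
    define \<delta> where "\<delta> = N z - 1"
    define h where "h = z - y"
    define Y where "Y = (1 / N z) *\<^sub>R z"
    have Y: "Y - y = (1 / N z) *\<^sub>R (h - \<delta> *\<^sub>R y)"
      using elim(3) by (simp add: Y_def h_def \<delta>_def algebra_simps)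
    have "norm (r Y - r y - D (Y - y)) \<le> \<eta> * norm (Y - y)"
      using d(2)[of Y] elim(2) by (simp add: Y_def dist_norm)
    then have "\<bar>D (Y - y)\<bar> \<le> \<eta> * norm (Y - y)" using elim(1) r(2) by (simp add: Y_def)
    then have "(1 / N z) * \<bar>D h - \<delta> * k\<bar> \<le> (1 / N z) * (\<eta> * norm (h - \<delta> *\<^sub>R y))"
      using elim(3) k(1) unfolding Y by (simp add: D.scaleR D.diff abs_mult)
    then have 1: "\<bar>D h - \<delta> * k\<bar> \<le> \<eta> * norm (h - \<delta> *\<^sub>R y)"
      by (rule mult_left_le_imp_le) (use elim(3) in simp)
    have "norm (h - \<delta> *\<^sub>R y) \<le> norm h + \<bar>\<delta>\<bar> * norm y"
      using norm_triangle_ineq4[of h "\<delta> *\<^sub>R y"] by simp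
    then have "\<eta> * norm (h - \<delta> *\<^sub>R y) \<le> \<eta> * (norm h + \<bar>\<delta>\<bar> * norm y)"
      using \<eta>(1) by (intro mult_left_mono) auto
    with 1 have 2: "\<bar>D h - \<delta> * k\<bar> \<le> \<eta> * norm h + \<eta> * norm y * \<bar>\<delta>\<bar>"
      by (simp add: algebra_simps)
    have "k * \<bar>\<delta>\<bar> = \<bar>\<delta> * k\<bar>" using k by (simp add: abs_mult)
    also have "\<dots> \<le> \<bar>D h\<bar> + \<bar>D h - \<delta> * k\<bar>" by arith
    also have "\<dots> \<le> M * norm h + 1 * norm h + k / 2 * \<bar>\<delta>\<bar>"
    proof -
      have "\<eta> * norm h \<le> 1 * norm h" using \<eta> by (intro mult_right_mono) auto
      moreover have "\<eta> * norm y * \<bar>\<delta>\<bar> \<le> k / 2 * \<bar>\<delta>\<bar>" using \<eta>2 by (intro mult_right_mono) auto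
      ultimately show ?thesis using 2 M(2)[of h] by linarith
    qed
    finally have "k / 2 * \<bar>\<delta>\<bar> \<le> (M + 1) * norm h"
      by (simp add: algebra_simps)
    also have "\<dots> = k / 2 * (C * norm h)" using k(2) by (simp add: C_def)
    finally have "k / 2 * \<bar>\<delta>\<bar> \<le> k / 2 * (C * norm h)" .
    then have 3: "\<bar>\<delta>\<bar> \<le> C * norm h" by (rule mult_left_le_imp_le) (use k in simp)
    have "\<eta> * norm y * \<bar>\<delta>\<bar> \<le> \<eta> * norm y * (C * norm h)"
      using 3 \<eta> by (intro mult_left_mono) auto
    then have "\<bar>D h - \<delta> * k\<bar> \<le> \<eta> * (1 + C * norm y) * norm h"
      using 2 by (simp add: algebra_simps)
    also have "\<dots> \<le> e * k * norm h" using \<eta>3 by (intro mult_right_mono) auto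
    finally have "k * \<bar>\<delta> - D h / k\<bar> \<le> k * (e * norm h)"
      using k by (simp add: abs_mult_pos' right_diff_distrib abs_minus_commute mult_ac)
    then have "\<bar>\<delta> - D h / k\<bar> \<le> e * norm h" by (rule mult_left_le_imp_le) (use k in simp)
    then show ?case using N(2) by (simp add: \<delta>_def h_def)
  qed
  then show "\<exists>d>0. \<forall>z. norm (z - y) < d \<longrightarrow> norm (N z - N y - D (z - y) / k) \<le> e * norm (z - y)"
    unfolding eventually_nhds_metric dist_norm .
qed

definition minkowski_gauge :: "'a::real_vector set \<Rightarrow> 'a \<Rightarrow> real" where
  "minkowski_gauge \<Omega> z = Inf {s. s > 0 \<and> (1 / s) *\<^sub>R z \<in> \<Omega>}"

locale circular_domain =
  fixes \<Omega> :: "(complex^'n) set"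
  assumes open_dom: "open \<Omega>" and nonempty: "\<Omega> \<noteq> {}" and bounded_dom: "bounded \<Omega>"
    and spc: "strongly_pseudoconvex \<Omega>" and circular: "complete_circular \<Omega>"
begin

abbreviation N :: "complex^'n \<Rightarrow> real" where "N \<equiv> minkowski_gauge \<Omega>"

lemma smult_mem: "z \<in> \<Omega> \<Longrightarrow> cmod a \<le> 1 \<Longrightarrow> a *s z \<in> \<Omega>"
  using circular by (auto simp: complete_circular_def)

lemma zero_mem: "0 \<in> \<Omega>"
  using nonempty smult_mem[of _ 0] by auto

lemma smult_mem_closure:
  assumes "z \<in> closure \<Omega>" "cmod a \<le> 1"
  shows "a *s z \<in> closure \<Omega>"
proof -
  have "continuous_on (closure \<Omega>) (\<lambda>z. a *s z)"
    using linear_continuous_on[OF bounded_linear_vector_smult] .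
  moreover have "(\<lambda>z. a *s z) ` \<Omega> \<subseteq> closure \<Omega>"
    using smult_mem assms(2) closure_subset by blast
  ultimately have "(\<lambda>z. a *s z) ` closure \<Omega> \<subseteq> closure \<Omega>"
    by (intro image_closure_subset) auto
  then show ?thesis using assms(1) by blast
qed

lemma rotate_mem_iff:
  assumes "cmod a = 1"
  shows "a *s z \<in> \<Omega> \<longleftrightarrow> z \<in> \<Omega>"
proof
  show "a *s z \<in> \<Omega>" if "z \<in> \<Omega>" using assms smult_mem[OF that] by simp
  show "z \<in> \<Omega>" if "a *s z \<in> \<Omega>"
  proof -
    have "cnj a * a = 1"
      using assms complex_norm_square[of a] by (simp add: mult.commute)
    then have "cnj a *s (a *s z) = z" by (simp add: vector_smult_assoc)
    moreover have "cnj a *s (a *s z) \<in> \<Omega>" using assms by (intro smult_mem that) simp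
    ultimately show ?thesis by metis
  qed
qed

lemma frontier_eq: "frontier \<Omega> = closure \<Omega> - \<Omega>"
  using open_dom by (simp add: frontier_def interior_open)

lemma rotate_frontier:
  assumes "p \<in> frontier \<Omega>" "cmod a = 1"
  shows "a *s p \<in> frontier \<Omega>"
  using assms smult_mem_closure[of p a] rotate_mem_iff[of a p] by (simp add: frontier_eq)

lemma ray_mono:
  assumes "0 < s" "s \<le> t" "(1 / s) *\<^sub>R z \<in> \<Omega>"
  shows "(1 / t) *\<^sub>R z \<in> \<Omega>"
proof -
  have "of_real (s / t) *s ((1 / s) *\<^sub>R z) \<in> \<Omega>"
    using assms by (intro smult_mem) (auto simp: norm_divide)
  moreover have "of_real (s / t) *s ((1 / s) *\<^sub>R z) = (1 / t) *\<^sub>R z"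
    using assms by (simp add: scaleR_eq_vector_smult vector_smult_assoc)
  ultimately show ?thesis by simp
qed

lemma ray_nonempty: "\<exists>s>0. (1 / s) *\<^sub>R z \<in> \<Omega>"
proof -
  obtain e where e: "e > 0" "ball 0 e \<subseteq> \<Omega>"
    using open_dom zero_mem open_contains_ball by blast
  define s where "s = norm z / e + 1"
  have s: "s > 0" using e(1) by (simp add: s_def add_nonneg_pos)
  have "norm z < e * s" using e(1) by (simp add: s_def algebra_simps)
  then have "norm ((1 / s) *\<^sub>R z) < e" using s by (simp add: field_simps)
  then show ?thesis using e(2) s by (intro exI[of _ s]) auto
qed

text \<open>Openness of the domain makes the set of admissible dilation factors open, so its infimum is not
  attained and the inequality is strict.\<close>

lemma gauge_less_iff:
  assumes "s > 0"
  shows "N z < s \<longleftrightarrow> (1 / s) *\<^sub>R z \<in> \<Omega>"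
proof
  let ?R = "{s. s > 0 \<and> (1 / s) *\<^sub>R z \<in> \<Omega>}"
  have ne: "?R \<noteq> {}" using ray_nonempty by auto
  have bb: "bdd_below ?R" by (rule bdd_belowI[of _ 0]) auto
  show "(1 / s) *\<^sub>R z \<in> \<Omega>" if less: "N z < s"
  proof -
    obtain t where "t \<in> ?R" "t < s"
      using less cInf_less_iff[OF ne bb, of s] unfolding minkowski_gauge_def by blast
    then show ?thesis using ray_mono[of t s z] by auto
  qed
  show "N z < s" if "(1 / s) *\<^sub>R z \<in> \<Omega>"
  proof -
    have "isCont (\<lambda>t. (1 / t) *\<^sub>R z) s" using assms by (intro continuous_intros) auto
    then have "((\<lambda>t. (1 / t) *\<^sub>R z) \<longlongrightarrow> (1 / s) *\<^sub>R z) (at_left s)"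
      unfolding isCont_def by (rule tendsto_mono[rotated]) (simp add: at_le)
    then have "\<forall>\<^sub>F t in at_left s. (1 / t) *\<^sub>R z \<in> \<Omega>"
      using open_dom that by (rule topological_tendstoD)
    moreover have "\<forall>\<^sub>F t in at_left s. t \<in> {0<..<s}"
      by (rule eventually_at_left_real[OF assms])
    ultimately have "\<forall>\<^sub>F t in at_left s. t \<in> ?R \<and> t < s"
      by eventually_elim auto
    then obtain t where "t \<in> ?R" "t < s"
      using eventually_happens'[OF trivial_limit_at_left_real] by blast
    then show ?thesis using cInf_less_iff[OF ne bb, of s] unfolding minkowski_gauge_def by blast
  qed
qed

lemma gauge_nonneg: "N z \<ge> 0"
  unfolding minkowski_gauge_def by (rule cInf_greatest) (use ray_nonempty in auto)

lemma gauge_less_1_iff: "N z < 1 \<longleftrightarrow> z \<in> \<Omega>"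
  using gauge_less_iff[of 1 z] by simp

lemma gauge_pos:
  assumes "z \<noteq> 0"
  shows "N z > 0"
proof -
  obtain B where B: "B > 0" "\<And>x. x \<in> \<Omega> \<Longrightarrow> norm x \<le> B"
    using bounded_dom bounded_pos by metis
  have "norm z / B \<le> N z"
    unfolding minkowski_gauge_def
  proof (rule cInf_greatest)
    fix s assume "s \<in> {s. s > 0 \<and> (1 / s) *\<^sub>R z \<in> \<Omega>}"
    then have s: "s > 0" "norm z / s \<le> B" using B(2)[of "(1 / s) *\<^sub>R z"] by auto
    then show "norm z / B \<le> s" using B(1) by (simp add: field_simps)
  qed (use ray_nonempty in auto)
  moreover have "norm z / B > 0" using assms B by simp
  ultimately show ?thesis by linarith
qed

lemma gauge_smult: "N (a *s z) = cmod a * N z"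
proof (cases "a = 0")
  case True
  have "N 0 < s" if "s > 0" for s
    using gauge_less_iff[OF that] zero_mem by simp
  then have "N 0 = 0" using gauge_nonneg[of 0] by (metis less_irrefl linorder_not_le order_antisym)
  then show ?thesis using True by simp
next
  case False
  have "N (a *s z) < s \<longleftrightarrow> cmod a * N z < s" if s: "s > 0" for s
  proof -
    have eq: "(1 / s) *\<^sub>R (a *s z) = sgn a *s ((1 / (s / cmod a)) *\<^sub>R z)"
    proof -
      have "of_real (1 / s) * a = sgn a * of_real (1 / (s / cmod a))"
        using False s by (simp add: sgn_div_norm scaleR_conv_of_real field_simps)
      then show ?thesis by (simp only: scaleR_eq_vector_smult vector_smult_assoc)
    qed
    have "N (a *s z) < s \<longleftrightarrow> (1 / (s / cmod a)) *\<^sub>R z \<in> \<Omega>"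
      unfolding gauge_less_iff[OF s] eq by (rule rotate_mem_iff) (simp add: norm_sgn False)
    also have "\<dots> \<longleftrightarrow> N z < s / cmod a" using s False by (intro gauge_less_iff[symmetric]) simp
    also have "\<dots> \<longleftrightarrow> cmod a * N z < s" using False by (simp add: field_simps)
    finally show ?thesis .
  qed
  note iff = this
  have "N (a *s z) \<le> cmod a * N z"
  proof (rule field_le_epsilon)
    fix e :: real assume e: "e > 0"
    then have "cmod a * N z + e > 0" by (simp add: add_nonneg_pos gauge_nonneg)
    from iff[OF this] e show "N (a *s z) \<le> cmod a * N z + e" by simp
  qed
  moreover have "cmod a * N z \<le> N (a *s z)"
  proof (rule field_le_epsilon)
    fix e :: real assume e: "e > 0"
    then have "N (a *s z) + e > 0" by (simp add: add_nonneg_pos gauge_nonneg)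
    from iff[OF this] e show "cmod a * N z \<le> N (a *s z) + e" by simp
  qed
  ultimately show ?thesis by simp
qed

lemma gauge_scaleR: "N (c *\<^sub>R z) = \<bar>c\<bar> * N z"
  by (simp add: scaleR_eq_vector_smult gauge_smult)

lemma defining_function_Ck_on: "local_defining_function \<Omega> U r \<Longrightarrow> open U \<and> Ck_on k U r"
  by (simp add: local_defining_function_def smooth_on_def)

lemma defining_function_nonpos:
  assumes "local_defining_function \<Omega> U r" "z \<in> closure \<Omega>" "z \<in> U"
  shows "r z \<le> 0"
proof (rule ccontr)
  assume "\<not> r z \<le> 0"
  have U: "open U" and c: "continuous_on U r"
    using defining_function_Ck_on[OF assms(1), of 0] by auto
  have "open {x \<in> U. r x \<in> {0<..}}"
    using continuous_open_preimage[OF c U open_greaterThan, of 0] by (simp add: Int_def vimage_def)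
  moreover have "z \<in> {x \<in> U. r x \<in> {0<..}}" using \<open>\<not> r z \<le> 0\<close> assms(3) by auto
  ultimately obtain x where "x \<in> \<Omega>" "x \<in> U" "r x > 0"
    using assms(2) unfolding closure_iff_nhds_not_empty by blast
  moreover have "\<Omega> \<inter> U = {z \<in> U. r z < 0}"
    using assms(1) by (simp add: local_defining_function_def)
  ultimately have "x \<in> {z \<in> U. r z < 0}" by blast
  then show False using \<open>r x > 0\<close> by simp
qed

lemma defining_function_zero:
  assumes "local_defining_function \<Omega> U r" "z \<in> frontier \<Omega>" "z \<in> U"
  shows "r z = 0"
proof -
  have "r z \<le> 0" using assms defining_function_nonpos by (auto simp: frontier_eq)
  moreover have "\<Omega> \<inter> U = {z \<in> U. r z < 0}"
    using assms(1) by (simp add: local_defining_function_def)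
  then have "\<not> r z < 0" using assms(2,3) unfolding frontier_eq by blast
  ultimately show ?thesis by simp
qed

text \<open>If the radial direction were tangent at \<open>p\<close>, the whole complex line through \<open>p\<close> would be
  tangent, since it always contains the tangent \<open>\<i> p\<close> of the circle through \<open>p\<close>. The second
  derivative of \<open>r\<close> in the direction \<open>\<i> p\<close> would vanish, because \<open>r\<close> is zero on that circle, so all of
  the positivity of the Levi form would sit in the radial direction. Then \<open>r\<close> would be positive at
  points \<open>t p\<close> with \<open>t < 1\<close>, although these lie in the closed domain.\<close>

lemma radial_derivative_pos:
  assumes r: "local_defining_function \<Omega> U r" and levi: "levi_positive_at r p"
    and p: "p \<in> frontier \<Omega>" "p \<in> U"
  shows "dir_deriv p r p > 0"
proof -
  have U: "open U" using defining_function_Ck_on[OF r] by simp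
  have C2: "Ck_on 2 U r" using defining_function_Ck_on[OF r] by blast
  then have C: "Ck_on (Suc (Suc 0)) U r" by (simp add: numeral_2_eq_2)
  have d: "r differentiable (at z)" if "z \<in> U" for z using Ck_on_differentiable[OF C that] .
  have dd: "dir_deriv v r differentiable (at z)" if "z \<in> U" for v z
    using Ck_on_differentiable[OF Ck_on_dir_deriv[OF C] that] .
  have r0: "r p = 0" using defining_function_zero[OF r p] .
  have p0: "p \<noteq> 0" using p zero_mem frontier_eq by auto
  have pc: "p \<in> closure \<Omega>" using p frontier_eq by auto
  have ray: "p + t *\<^sub>R p \<in> closure \<Omega>" if "-1 \<le> t" "t \<le> 0" for t
  proof -
    have "of_real (1 + t) *s p \<in> closure \<Omega>"
      by (rule smult_mem_closure[OF pc]) (use that in \<open>simp add: norm_of_real del: of_real_add\<close>)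
    then show ?thesis by (simp only: scaleR_eq_vector_smult[symmetric] scaleR_add_left scaleR_one)
  qed
  obtain \<epsilon> where \<epsilon>: "\<epsilon> > 0" "\<And>t. \<bar>t\<bar> < \<epsilon> \<Longrightarrow> p + t *\<^sub>R p \<in> U"
  proof -
    obtain e where e: "e > 0" "ball p e \<subseteq> U" using U p(2) open_contains_ball by blast
    have "p + t *\<^sub>R p \<in> U" if "\<bar>t\<bar> < e / norm p" for t
    proof -
      have "\<bar>t\<bar> * norm p < e" using that p0 by (simp add: field_simps)
      then show ?thesis using e(2) by (auto simp: dist_norm)
    qed
    then show ?thesis using that[of "e / norm p"] e(1) p0 by simp
  qed
  have ray_nonpos: "r (p + t *\<^sub>R p) \<le> 0" if "- min 1 \<epsilon> < t" "t \<le> 0" for t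
    using defining_function_nonpos[OF r ray[of t] \<epsilon>(2)[of t]] that by simp
  define \<phi> where "\<phi> t = r (p + t *\<^sub>R p)" for t
  have d\<phi>: "(\<phi> has_real_derivative dir_deriv p r (p + t *\<^sub>R p)) (at t)" if "\<bar>t\<bar> < \<epsilon>" for t
    unfolding \<phi>_def by (rule has_real_derivative_along_line[OF d[OF \<epsilon>(2)[OF that]]])
  have nonneg: "dir_deriv p r p \<ge> 0"
  proof (rule ccontr)
    assume "\<not> ?thesis"
    then obtain e where e: "e > 0" "\<And>h. h > 0 \<Longrightarrow> h < e \<Longrightarrow> \<phi> 0 < \<phi> (0 - h)"
      using DERIV_neg_dec_left[OF d\<phi>[of 0]] \<epsilon>(1) by auto
    define h where "h = min e (min 1 \<epsilon>) / 2"
    have "\<phi> (0 - h) > 0" using e(2)[of h] e(1) \<epsilon>(1) r0 by (auto simp: h_def \<phi>_def min_def)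
    moreover have "r (p + (- h) *\<^sub>R p) \<le> 0"
      by (rule ray_nonpos) (use e(1) \<epsilon>(1) in \<open>auto simp: h_def min_def\<close>)
    ultimately show False by (simp add: \<phi>_def)
  qed
  moreover have "dir_deriv p r p \<noteq> 0"
  proof
    assume rad0: "dir_deriv p r p = 0"
    define c where "c t = cis t *s p" for t
    have c0: "c 0 = p" by (simp add: c_def)
    have hc: "(c has_derivative (\<lambda>h. h *\<^sub>R ((\<i> * cis t) *s p))) (at t)" for t
    proof -
      have "(cis has_derivative (\<lambda>h. h *\<^sub>R (\<i> * cis t))) (at t)"
        using has_derivative_cis[OF has_derivative_ident] .
      from bounded_linear.has_derivative[OF bounded_linear_vector_smult_left this, of p]
      show ?thesis unfolding c_def
        by (simp add: linear_cmul[OF bounded_linear.linear[OF bounded_linear_vector_smult_left]])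
    qed
    have cfr: "c t \<in> frontier \<Omega>" for t
      unfolding c_def by (rule rotate_frontier[OF p(1)]) simp
    have "isCont c 0" using hc[of 0] has_derivative_continuous by blast
    then have "(c \<longlongrightarrow> p) (nhds 0)"
      using tendsto_at_iff_tendsto_nhds[of c 0] c0 by (simp add: isCont_def)
    then have cU: "\<forall>\<^sub>F t in nhds 0. c t \<in> U" using U p(2) by (rule topological_tendstoD)
    have rc: "\<forall>\<^sub>F t in nhds 0. r (c t) = 0"
      using cU by eventually_elim (rule defining_function_zero[OF r cfr])
    have hrc: "((\<lambda>t. r (c t)) has_real_derivative dir_deriv ((\<i> * cis t) *s p) r (c t)) (at t)"
      if "c t \<in> U" for t
    proof -
      have "((\<lambda>t. r (c t)) has_derivative
          (\<lambda>h. dir_deriv (h *\<^sub>R ((\<i> * cis t) *s p)) r (c t))) (at t)"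
        using has_derivative_compose[OF hc] d[OF that] frechet_derivative_works by blast
      then show ?thesis
        unfolding has_field_derivative_def linear_dir_deriv(2)[OF d[OF that]]
        by (simp add: mult_commute_abs)
    qed
    have split: "dir_deriv ((\<i> * cis t) *s p) r z
        = cos t * dir_deriv (\<i> *s p) r z - sin t * dir_deriv p r z" if "z \<in> U" for t z
    proof -
      have "(\<i> * cis t) *s p = cos t *\<^sub>R (\<i> *s p) + (- sin t) *\<^sub>R p"
        by (simp add: vec_eq_iff complex_eq_iff algebra_simps)
      then show ?thesis
        by (simp only: linear_dir_deriv(1,2)[OF d[OF that]]) simp
    qed
    have evd: "\<forall>\<^sub>F t in nhds 0. dir_deriv ((\<i> * cis t) *s p) r (c t) = 0"
    proof -
      have "\<forall>\<^sub>F t in nhds 0. \<forall>\<^sub>F u in nhds t. r (c u) = 0"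
        using rc by (simp add: eventually_eventually)
      with cU show ?thesis
      proof eventually_elim
        case (elim t)
        have "((\<lambda>t. 0 :: real) has_real_derivative dir_deriv ((\<i> * cis t) *s p) r (c t)) (at t)"
          using DERIV_cong_ev[OF refl elim(2) refl] hrc[OF elim(1)] by simp
        then show ?case using DERIV_unique DERIV_const by blast
      qed
    qed
    have circ0: "dir_deriv (\<i> *s p) r p = 0"
      using eventually_nhds_x_imp_x[OF evd] by (simp add: c0)
    have hdir: "((\<lambda>t. dir_deriv v r (c t)) has_real_derivative
        dir_deriv (\<i> *s p) (dir_deriv v r) p) (at 0)" for v
    proof -
      have "((\<lambda>t. dir_deriv v r (c t)) has_derivative
          (\<lambda>h. dir_deriv (h *\<^sub>R ((\<i> * cis 0) *s p)) (dir_deriv v r) (c 0))) (at 0)"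
      proof (rule has_derivative_compose[OF hc])
        show "(dir_deriv v r has_derivative frechet_derivative (dir_deriv v r) (at (c 0))) (at (c 0))"
          unfolding c0 using dd[OF p(2)] frechet_derivative_works by blast
      qed
      then show ?thesis
        unfolding has_field_derivative_def c0 linear_dir_deriv(2)[OF dd[OF p(2)]]
        by (simp add: mult_commute_abs)
    qed
    have second: "((\<lambda>t. cos t * dir_deriv (\<i> *s p) r (c t) - sin t * dir_deriv p r (c t))
        has_real_derivative dir_deriv (\<i> *s p) (dir_deriv (\<i> *s p) r) p) (at 0)"
      by (auto intro!: derivative_eq_intros hdir simp: c0 rad0)
    have zero: "\<forall>\<^sub>F t in nhds 0. cos t * dir_deriv (\<i> *s p) r (c t) - sin t * dir_deriv p r (c t) = 0"
      using evd cU by eventually_elim (simp add: split)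
    have "((\<lambda>t. 0 :: real) has_real_derivative
        dir_deriv (\<i> *s p) (dir_deriv (\<i> *s p) r) p) (at 0)"
      using iffD1[OF DERIV_cong_ev[OF refl zero refl] second] .
    then have "dir_deriv (\<i> *s p) (dir_deriv (\<i> *s p) r) p = 0"
      using DERIV_unique DERIV_const by blast
    then have pos: "dir_deriv p (dir_deriv p r) p > 0"
      using levi_positive_at_real[OF U p(2) C2 levi p0 rad0 circ0] by simp
    have "((\<lambda>t. dir_deriv p r (p + t *\<^sub>R p)) has_real_derivative dir_deriv p (dir_deriv p r) p) (at 0)"
      using has_real_derivative_along_line[of "dir_deriv p r" p 0 p] dd[OF p(2)] by simp
    from DERIV_pos_inc_left[OF this pos]
    obtain e where e: "e > 0" "\<And>h. h > 0 \<Longrightarrow> h < e \<Longrightarrow> dir_deriv p r (p + (0 - h) *\<^sub>R p) < 0"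
      using rad0 by auto
    define h where "h = min e (min 1 \<epsilon>) / 2"
    have h: "h > 0" "h < e" "h < 1" "h < \<epsilon>" using e(1) \<epsilon>(1) by (auto simp: h_def min_def)
    have "\<exists>z>-h. z < 0 \<and> \<phi> 0 - \<phi> (-h) = (0 - (-h)) * dir_deriv p r (p + z *\<^sub>R p)"
      using h by (intro MVT2 d\<phi>) auto
    then obtain z where z: "-h < z" "z < 0" "\<phi> 0 - \<phi> (-h) = h * dir_deriv p r (p + z *\<^sub>R p)"
      by auto
    have "dir_deriv p r (p + z *\<^sub>R p) < 0" using e(2)[of "-z"] z h by simp
    then have "\<phi> 0 - \<phi> (-h) < 0" using z(3) h(1) by (simp add: mult_pos_neg)
    moreover have "\<phi> (-h) \<le> 0" unfolding \<phi>_def by (rule ray_nonpos) (use h in auto)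
    ultimately show False using r0 by (simp add: \<phi>_def)
  qed
  ultimately show ?thesis by simp
qed

lemma gauge_frontier:
  assumes "p \<in> frontier \<Omega>"
  shows "N p = 1"
proof -
  obtain U r where r: "p \<in> U" "local_defining_function \<Omega> U r" "levi_positive_at r p"
    using spc assms unfolding strongly_pseudoconvex_def by blast
  have U: "open U" "Ck_on (Suc 0) U r" using defining_function_Ck_on[OF r(2)] by blast+
  have r0: "r p = 0" using defining_function_zero[OF r(2) assms r(1)] .
  have "((\<lambda>t. r (p + t *\<^sub>R p)) has_real_derivative dir_deriv p r p) (at 0)"
    using has_real_derivative_along_line[of r p 0 p] Ck_on_differentiable[OF U(2) r(1)] by simp
  from DERIV_pos_inc_left[OF this radial_derivative_pos[OF r(2,3) assms r(1)]]
  obtain e where e: "e > 0" "\<And>h. h > 0 \<Longrightarrow> h < e \<Longrightarrow> r (p + (0 - h) *\<^sub>R p) < 0"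
    using r0 by auto
  have "((\<lambda>h. p + (0 - h) *\<^sub>R p) \<longlongrightarrow> p + (0 - 0) *\<^sub>R p) (at_right 0)"
    by (intro tendsto_intros)
  then have "\<forall>\<^sub>F h in at_right 0. p + (0 - h) *\<^sub>R p \<in> U"
    using U(1) r(1) by (intro topological_tendstoD) auto
  moreover have "\<forall>\<^sub>F h in at_right (0::real). h \<in> {0<..<min e 1}"
    using e(1) by (intro eventually_at_right_real) auto
  ultimately have "\<forall>\<^sub>F h in at_right (0::real). N p < 1 / (1 - h)"
  proof eventually_elim
    case (elim h)
    have "p + (0 - h) *\<^sub>R p \<in> \<Omega> \<inter> U"
      using e(2)[of h] elim r(2) by (auto simp: local_defining_function_def)
    then have "(1 / (1 / (1 - h))) *\<^sub>R p \<in> \<Omega>" by (simp add: algebra_simps)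
    then show ?case using gauge_less_iff[of "1 / (1 - h)" p] elim by auto
  qed
  moreover have "((\<lambda>h::real. 1 / (1 - h)) \<longlongrightarrow> 1 / (1 - 0)) (at_right 0)"
    by (intro tendsto_intros) auto
  ultimately have "N p \<le> 1"
    by (intro tendsto_le[OF trivial_limit_at_right_real _ tendsto_const])
      (auto elim: eventually_mono)
  moreover have "\<not> N p < 1" using assms by (simp add: gauge_less_1_iff frontier_eq)
  ultimately show ?thesis by simp
qed

text \<open>One direction is transversality, which prevents a ray from staying in the boundary; the other
  holds because the points \<open>t p\<close> with \<open>t < 1\<close> lie in the domain and converge to \<open>p\<close>.\<close>

lemma gauge_eq_1_iff: "N p = 1 \<longleftrightarrow> p \<in> frontier \<Omega>"
proof
  assume N1: "N p = 1"
  have "((\<lambda>t. of_real t *s p) \<longlongrightarrow> of_real 1 *s p) (at_left 1)"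
    by (intro bounded_bilinear.tendsto[OF bounded_bilinear_vector_smult] tendsto_intros)
  moreover have "\<forall>\<^sub>F t in at_left (1::real). t \<in> {0<..<1}"
    by (rule eventually_at_left_real) simp
  then have "\<forall>\<^sub>F t in at_left 1. of_real t *s p \<in> closure \<Omega>"
  proof eventually_elim
    case (elim t)
    then have "of_real t *s p \<in> \<Omega>"
      using N1 by (subst gauge_less_1_iff[symmetric]) (simp add: gauge_smult)
    then show ?case using closure_subset by blast
  qed
  ultimately have "p \<in> closure \<Omega>"
    using Lim_in_closed_set[OF closed_closure] trivial_limit_at_left_real by fastforce
  then show "p \<in> frontier \<Omega>" using N1 gauge_less_1_iff[of p] by (simp add: frontier_eq)
qed (rule gauge_frontier)

lemma gauge_le_1_iff: "N z \<le> 1 \<longleftrightarrow> z \<in> closure \<Omega>"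
  using gauge_less_1_iff gauge_eq_1_iff closure_subset frontier_eq by (auto simp: order_le_less)

text \<open>Strict sublevel sets of the gauge are dilates of the open domain, and sublevel sets are dilates
  of its closure.\<close>

lemma isCont_gauge:
  assumes z: "z \<noteq> 0"
  shows "isCont N z"
  unfolding isCont_def
proof (rule order_tendstoI)
  have sc: "isCont (\<lambda>x. (1 / s) *\<^sub>R x) z" for s :: real by (intro continuous_intros)
  have ev: "\<forall>\<^sub>F x in at z. (1 / s) *\<^sub>R x \<in> A" if "open A" "(1 / s) *\<^sub>R z \<in> A" for A and s :: real
    using sc[of s] that unfolding isCont_def by (rule topological_tendstoD)
  show "\<forall>\<^sub>F x in at z. N x < b" if "N z < b" for b
  proof -
    have b: "b > 0" using that gauge_pos[OF z] by linarith
    show ?thesis using ev[OF open_dom, of b] gauge_less_iff[OF b] that by simp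
  qed
  show "\<forall>\<^sub>F x in at z. a < N x" if "a < N z" for a
  proof -
    define b where "b = max a (N z / 2)"
    have b: "b > 0" "a \<le> b" "b < N z" using gauge_pos[OF z] that by (auto simp: b_def)
    have iff: "(1 / b) *\<^sub>R x \<in> - closure \<Omega> \<longleftrightarrow> b < N x" for x
      using b(1) by (simp add: gauge_le_1_iff[symmetric] gauge_scaleR not_le field_simps)
    have "\<forall>\<^sub>F x in at z. b < N x"
      using ev[of "- closure \<Omega>" b] iff b(3) by (simp add: open_Compl)
    then show ?thesis using b(2) by (auto elim: eventually_mono)
  qed
qed

definition radial_proj :: "complex^'n \<Rightarrow> complex^'n" where
  "radial_proj z = (1 / N z) *\<^sub>R z"

lemma radial_proj_frontier: "z \<noteq> 0 \<Longrightarrow> radial_proj z \<in> frontier \<Omega>"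
  using gauge_pos[of z] by (simp add: radial_proj_def gauge_eq_1_iff[symmetric] gauge_scaleR)

lemma continuous_on_radial_proj: "continuous_on (UNIV - {0}) radial_proj"
proof -
  have "continuous_on (UNIV - {0}) N"
    using isCont_gauge by (auto intro: continuous_at_imp_continuous_on)
  moreover have "\<forall>z\<in>UNIV - {0}. N z \<noteq> 0"
  proof
    fix z :: "complex^'n" assume "z \<in> UNIV - {0}"
    then show "N z \<noteq> 0" using gauge_pos[of z] by simp
  qed
  ultimately show ?thesis unfolding radial_proj_def[abs_def] by (intro continuous_intros)
qed

lemma frontier_nonzero: "p \<in> frontier \<Omega> \<Longrightarrow> p \<noteq> 0"
  using zero_mem frontier_eq by auto

lemma radial_proj_id: "p \<in> frontier \<Omega> \<Longrightarrow> radial_proj p = p"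
  by (simp add: radial_proj_def gauge_frontier)

text \<open>The derivative is first computed at the boundary point on the ray of \<open>z\<close>; it is homogeneous of
  degree zero, so the same formula holds at \<open>z\<close>.\<close>

lemma gauge_has_derivative:
  assumes z: "z \<noteq> 0" and U: "open U" "radial_proj z \<in> U" and r: "local_defining_function \<Omega> U r"
    and pos: "dir_deriv (radial_proj z) r (radial_proj z) > 0"
  shows "(N has_derivative (\<lambda>v. dir_deriv v r (radial_proj z)
           / dir_deriv (radial_proj z) r (radial_proj z))) (at z)"
proof -
  define y where "y = radial_proj z"
  define D where "D = (\<lambda>v. dir_deriv v r y / dir_deriv y r y)"
  have yf: "y \<in> frontier \<Omega>" using radial_proj_frontier[OF z] by (simp add: y_def)
  have y0: "y \<noteq> 0" using frontier_nonzero[OF yf] .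
  have C1: "Ck_on (Suc 0) U r" using defining_function_Ck_on[OF r] by blast
  have "isCont radial_proj y"
    using continuous_on_radial_proj y0
    by (metis Diff_iff UNIV_I continuous_on_eq_continuous_at empty_iff insert_iff open_UNIV open_delete)
  then have "(radial_proj \<longlongrightarrow> y) (nhds y)"
    using tendsto_at_iff_tendsto_nhds[of radial_proj y] radial_proj_id[OF yf] by (simp add: isCont_def)
  then have "\<forall>\<^sub>F x in nhds y. radial_proj x \<in> U"
    using U unfolding y_def[symmetric] by (rule topological_tendstoD)
  moreover have "\<forall>\<^sub>F x in nhds y. x \<noteq> 0" using y0 by (rule t1_space_nhds)
  ultimately have "\<forall>\<^sub>F x in nhds y. r ((1 / N x) *\<^sub>R x) = 0"
    by eventually_elim
      (use defining_function_zero[OF r radial_proj_frontier] in \<open>simp add: radial_proj_def\<close>)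
  then have hy: "(N has_derivative D) (at y)"
    unfolding D_def using isCont_gauge[OF y0] gauge_frontier[OF yf]
      Ck_on_has_derivative[OF C1 U(2)[folded y_def]] defining_function_zero[OF r yf U(2)[folded y_def]]
      pos[folded y_def]
    by (intro has_derivative_radial_function) auto
  have Nz: "N z > 0" using gauge_pos[OF z] .
  have "((\<lambda>x. (1 / N z) *\<^sub>R x) has_derivative (\<lambda>v. (1 / N z) *\<^sub>R v)) (at z)"
    by (auto intro!: derivative_eq_intros)
  from has_derivative_compose[OF this, of N D]
  have "((\<lambda>x. N ((1 / N z) *\<^sub>R x)) has_derivative (\<lambda>v. D ((1 / N z) *\<^sub>R v))) (at z)"
    using hy by (simp add: y_def radial_proj_def)
  from has_derivative_mult_right[OF this, of "N z"]
  have "((\<lambda>x. N z * N ((1 / N z) *\<^sub>R x)) has_derivative (\<lambda>v. N z * D ((1 / N z) *\<^sub>R v))) (at z)" .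
  moreover have "(\<lambda>x. N z * N ((1 / N z) *\<^sub>R x)) = N"
    using Nz by (simp add: gauge_scaleR fun_eq_iff)
  moreover have "(\<lambda>v. N z * D ((1 / N z) *\<^sub>R v)) = D"
    using Nz linear_dir_deriv(2)[OF Ck_on_differentiable[OF C1 U(2)[folded y_def]]]
    by (simp add: D_def fun_eq_iff)
  ultimately show ?thesis by (simp add: D_def y_def)
qed

text \<open>The derivative of the gauge at \<open>z\<close> is a smooth function of \<open>radial_proj z\<close>, and \<open>radial_proj\<close> is
  as regular as the gauge itself: each pass gains one derivative. The neighbourhood \<open>W\<close> must not
  shrink during the induction, so it is fixed in advance by the condition that the radial
  derivative of \<open>r\<close> stays positive.\<close>

lemma gauge_smooth_near:
  assumes r: "local_defining_function \<Omega> U r" and levi: "levi_positive_at r p"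
    and p: "p \<in> frontier \<Omega>" "p \<in> U" and z0: "z\<^sub>0 \<noteq> 0" "radial_proj z\<^sub>0 = p"
  obtains W where "open W" "z\<^sub>0 \<in> W" "0 \<notin> W" "radial_proj ` W \<subseteq> U"
    "\<And>z. z \<in> W \<Longrightarrow> dir_deriv (radial_proj z) r (radial_proj z) > 0"
    "\<And>k. Ck_on k W N"
proof -
  have U: "open U" and C: "\<And>k. Ck_on k U r" using defining_function_Ck_on[OF r] by blast+
  define E where "E y = (\<Sum>b\<in>Basis. (y \<bullet> b) * dir_deriv b r y)" for y
  have d: "r differentiable (at y)" if "y \<in> U" for y using Ck_on_differentiable[OF C that] .
  have E: "dir_deriv y r y = E y" if "y \<in> U" for y
    using dir_deriv_expand[OF d[OF that], of y] by (simp add: E_def)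
  have CE: "Ck_on k U E" for k
    unfolding E_def[abs_def]
    by (intro Ck_on_sum[OF U] finite_Basis Ck_on_mult[OF U]
        Ck_on_bounded_linear[OF bounded_linear_inner_left] Ck_on_dir_deriv[OF C])
  define V where "V = {y \<in> U. E y \<in> {0<..}}"
  have V: "open V"
    using continuous_open_preimage[OF Ck_on_continuous_on[OF CE] U open_greaterThan, of 0]
    by (simp add: V_def Int_def vimage_def)
  define W where "W = {z \<in> UNIV - {0}. radial_proj z \<in> V}"
  have W: "open W"
    using continuous_open_preimage[OF continuous_on_radial_proj _ V]
    by (simp add: W_def Int_def vimage_def open_delete)
  have "E p > 0" using radial_derivative_pos[OF r levi p] E[OF p(2)] by simp
  then have z0W: "z\<^sub>0 \<in> W" using z0 p by (simp add: W_def V_def)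
  have RU: "radial_proj ` W \<subseteq> V" by (auto simp: W_def)
  have pos: "dir_deriv (radial_proj z) r (radial_proj z) > 0" if "z \<in> W" for z
    using that E by (auto simp: W_def V_def)
  define n where "n v y = dir_deriv v r y * inverse (E y)" for v y
  have Cn: "Ck_on k V (n v)" for k v
    unfolding n_def[abs_def]
    by (intro Ck_on_mult[OF V] Ck_on_inverse[OF V])
      (auto intro!: Ck_on_subset[OF CE] Ck_on_subset[OF Ck_on_dir_deriv[OF C]] simp: V_def)
  have hN: "(N has_derivative (\<lambda>v. n v (radial_proj z))) (at z)" if "z \<in> W" for z
  proof -
    have "radial_proj z \<in> U" "z \<noteq> 0" using that by (auto simp: W_def V_def)
    then show ?thesis
      using gauge_has_derivative[OF _ U _ r pos[OF that]] E by (simp add: n_def divide_inverse)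
  qed
  have "Ck_on k W N" for k
  proof (induction k)
    case 0
    have "continuous_on W N"
      using isCont_gauge by (auto simp: W_def intro!: continuous_at_imp_continuous_on)
    then show ?case by simp
  next
    case (Suc k)
    have "Ck_on k W (\<lambda>z. inverse (N z) *\<^sub>R z)"
      by (intro Ck_on_scaleR[OF W] Ck_on_inverse[OF W] Suc.IH Ck_on_bounded_linear bounded_linear_ident)
        (use gauge_pos in \<open>force simp: W_def\<close>)
    then have "Ck_on k W radial_proj"
      by (simp add: radial_proj_def[abs_def] inverse_eq_divide)
    then have Ck_der: "Ck_on k W (\<lambda>z. n v (radial_proj z))" for v
      by (rule Ck_on_compose[OF W RU Cn])
    show ?case by (rule Ck_on_SucI[OF W hN Ck_der])
  qed
  moreover have "radial_proj ` W \<subseteq> U" using RU by (auto simp: V_def)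
  moreover have "0 \<notin> W" by (simp add: W_def)
  ultimately show ?thesis using that W z0W pos by blast
qed

lemma Ck_on_gauge: "Ck_on k (UNIV - {0}) N"
proof (rule Ck_on_local)
  fix z :: "complex^'n" assume "z \<in> UNIV - {0}"
  then have z: "z \<noteq> 0" by simp
  obtain U r where r: "radial_proj z \<in> U" "local_defining_function \<Omega> U r" "levi_positive_at r (radial_proj z)"
    using spc radial_proj_frontier[OF z] unfolding strongly_pseudoconvex_def by blast
  show "\<exists>V. open V \<and> z \<in> V \<and> Ck_on k V N"
    using gauge_smooth_near[OF r(2,3) radial_proj_frontier[OF z] r(1) z refl] by metis
qed

definition gauge_sq :: "complex^'n \<Rightarrow> real" where "gauge_sq z = N z * N z"

lemma Ck_on_gauge_sq: "Ck_on k (UNIV - {0}) gauge_sq"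
  unfolding gauge_sq_def[abs_def] by (intro Ck_on_mult Ck_on_gauge) (simp add: open_delete)

text \<open>Near \<open>p\<close> the derivative of \<open>N\<^sup>2\<close> along \<open>u\<close> is \<open>2 N\<close> times the quotient of \<open>dir_deriv u r\<close> by the
  radial derivative of \<open>r\<close>, both evaluated at \<open>radial_proj z\<close>. If \<open>u\<close> is tangent at \<open>p\<close>, then
  \<open>radial_proj\<close> has derivative \<open>u\<close> in the direction \<open>u\<close>, and only the numerator contributes to the
  next derivative. So along tangent vectors the second derivatives of \<open>N\<^sup>2\<close> at \<open>p\<close> are those of \<open>r\<close>,
  divided by half of the positive number \<open>dir_deriv p r p\<close>.\<close>

lemma gauge_sq_levi_positive:
  assumes p: "p \<in> frontier \<Omega>"
    and w: "w \<noteq> 0" "dir_deriv w gauge_sq p = 0" "dir_deriv (\<i> *s w) gauge_sq p = 0"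
  shows "dir_deriv w (dir_deriv w gauge_sq) p
    + dir_deriv (\<i> *s w) (dir_deriv (\<i> *s w) gauge_sq) p > 0"
proof -
  have p0: "p \<noteq> 0" using frontier_nonzero[OF p] .
  have Np: "N p = 1" using gauge_frontier[OF p] .
  obtain U r where r: "p \<in> U" "local_defining_function \<Omega> U r" "levi_positive_at r p"
    using spc p unfolding strongly_pseudoconvex_def by blast
  have U: "open U" and C: "\<And>k. Ck_on k U r" using defining_function_Ck_on[OF r(2)] by blast+
  obtain W where W: "open W" "p \<in> W" "0 \<notin> W" "radial_proj ` W \<subseteq> U"
    "\<And>z. z \<in> W \<Longrightarrow> dir_deriv (radial_proj z) r (radial_proj z) > 0" "\<And>k. Ck_on k W N"
    using gauge_smooth_near[OF r(2,3) p r(1) p0 radial_proj_id[OF p]] by metis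
  define E where "E y = (\<Sum>b\<in>Basis. (y \<bullet> b) * dir_deriv b r y)" for y
  have d: "r differentiable (at y)" if "y \<in> U" for y using Ck_on_differentiable[OF C that] .
  have E: "dir_deriv y r y = E y" if "y \<in> U" for y
    using dir_deriv_expand[OF d[OF that], of y] by (simp add: E_def)
  have Ep: "E p > 0" using W(5)[OF W(2)] radial_proj_id[OF p] E[OF r(1)] by simp
  have dE: "E differentiable (at p)"
    unfolding E_def[abs_def]
    by (intro differentiable_sum finite_Basis ballI differentiable_mult
        Ck_on_differentiable[OF Ck_on_dir_deriv[OF C] r(1)])
      (auto intro!: derivative_intros simp: differentiable_def)
  have hN: "(N has_derivative (\<lambda>v. dir_deriv v r (radial_proj z) / E (radial_proj z))) (at z)"
    if "z \<in> W" for z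
  proof -
    have "radial_proj z \<in> U" "z \<noteq> 0" using that W by auto
    then show ?thesis using gauge_has_derivative[OF _ U _ r(2) W(5)[OF that]] E by simp
  qed
  have hNp: "(N has_derivative (\<lambda>v. dir_deriv v r p / E p)) (at p)"
    using hN[OF W(2)] radial_proj_id[OF p] by simp
  have dH: "dir_deriv v gauge_sq z = 2 * N z * (dir_deriv v r (radial_proj z) / E (radial_proj z))"
    if "z \<in> W" for v z
    unfolding gauge_sq_def[abs_def]
    by (rule dir_deriv_eqI[OF has_derivative_eq_rhs[OF has_derivative_mult[OF hN[OF that] hN[OF that]]]])
      (simp add: fun_eq_iff)
  have tang: "dir_deriv w r p = 0" "dir_deriv (\<i> *s w) r p = 0"
    using w dH[OF W(2)] Np Ep radial_proj_id[OF p] by auto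
  have second: "dir_deriv u (dir_deriv u gauge_sq) p = 2 * dir_deriv u (dir_deriv u r) p / E p"
    if u: "dir_deriv u r p = 0" for u
  proof -
    have Y: "(radial_proj has_derivative (\<lambda>v. v - (dir_deriv v r p / E p) *\<^sub>R p)) (at p)"
      unfolding radial_proj_def[abs_def]
      by (rule derivative_eq_intros hNp refl | simp add: Np)+
    have hD: "(dir_deriv u r has_derivative frechet_derivative (dir_deriv u r) (at (radial_proj p)))
        (at (radial_proj p))"
      using Ck_on_has_derivative[OF Ck_on_dir_deriv[OF C] r(1)] radial_proj_id[OF p] by metis
    have hE: "(E has_derivative frechet_derivative E (at (radial_proj p))) (at (radial_proj p))"
      using dE radial_proj_id[OF p] frechet_derivative_works by metis
    have "((\<lambda>z. 2 * N z * (dir_deriv u r (radial_proj z) / E (radial_proj z))) has_derivative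
        (\<lambda>v. 2 * dir_deriv (v - (dir_deriv v r p / E p) *\<^sub>R p) (dir_deriv u r) p / E p)) (at p)"
      by (rule derivative_eq_intros hNp has_derivative_compose[OF Y hD] has_derivative_compose[OF Y hE] refl
          | use Ep in \<open>simp add: radial_proj_id[OF p] Np u\<close>)+
    then have "(dir_deriv u gauge_sq has_derivative
        (\<lambda>v. 2 * dir_deriv (v - (dir_deriv v r p / E p) *\<^sub>R p) (dir_deriv u r) p / E p)) (at p)"
      by (rule has_derivative_transform_within_open[OF _ W(1,2)]) (simp add: dH)
    from dir_deriv_eqI[OF this, of u] show ?thesis by (simp add: u)
  qed
  have "dir_deriv w (dir_deriv w r) p + dir_deriv (\<i> *s w) (dir_deriv (\<i> *s w) r) p > 0"
    by (rule levi_positive_at_real[OF U r(1) C r(3) w(1) tang])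
  then have "2 * (dir_deriv w (dir_deriv w r) p + dir_deriv (\<i> *s w) (dir_deriv (\<i> *s w) r) p) / E p > 0"
    using Ep by simp
  then show ?thesis
    by (simp add: second[OF tang(1)] second[OF tang(2)] add_divide_distrib distrib_left)
qed

end

section \<open>Circular homogeneous functions\<close>

locale circular_homogeneous =
  fixes H :: "complex^'n \<Rightarrow> real"
  assumes smooth: "Ck_on k (UNIV - {0}) H"
    and homogeneous: "H (a *s z) = (cmod a)\<^sup>2 * H z"
begin

lemma open_punctured: "open (UNIV - {0 :: complex^'n})"
  by (simp add: open_delete)

lemma H_differentiable: "z \<noteq> 0 \<Longrightarrow> H differentiable (at z)"
  using Ck_on_differentiable[OF smooth] by simp

lemma dir_deriv_H_differentiable: "z \<noteq> 0 \<Longrightarrow> dir_deriv v H differentiable (at z)"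
  using Ck_on_differentiable[OF Ck_on_dir_deriv[OF smooth]] by simp

lemmas dir_deriv_H_linear = linear_dir_deriv[OF H_differentiable]

lemmas second_deriv_H_bilinear =
  dir_deriv_dir_deriv_linear[OF open_punctured smooth, unfolded Diff_iff singleton_iff, simplified]

text \<open>The complex form of Euler's identity.\<close>

lemma H_radial:
  assumes z: "z \<noteq> 0"
  shows "dir_deriv (\<alpha> *s z) H z = 2 * Re \<alpha> * H z"
proof -
  have eq: "(\<lambda>t. H (z + t *\<^sub>R (\<alpha> *s z))) = (\<lambda>t. ((1 + t * Re \<alpha>)\<^sup>2 + (t * Im \<alpha>)\<^sup>2) * H z)"
  proof
    fix t
    have "z + t *\<^sub>R (\<alpha> *s z) = (1 + of_real t * \<alpha>) *s z"
      by (simp only: scaleR_eq_vector_smult vector_smult_assoc vector_sadd_rdistrib vector_smult_lid)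
    then have "H (z + t *\<^sub>R (\<alpha> *s z)) = (cmod (1 + of_real t * \<alpha>))\<^sup>2 * H z"
      by (simp only: homogeneous)
    then show "H (z + t *\<^sub>R (\<alpha> *s z)) = ((1 + t * Re \<alpha>)\<^sup>2 + (t * Im \<alpha>)\<^sup>2) * H z"
      by (simp add: cmod_power2)
  qed
  have "((\<lambda>t. H (z + t *\<^sub>R (\<alpha> *s z))) has_real_derivative dir_deriv (\<alpha> *s z) H z) (at 0)"
    using has_real_derivative_along_line[of H z 0 "\<alpha> *s z"] H_differentiable[OF z] by simp
  moreover have "((\<lambda>t. H (z + t *\<^sub>R (\<alpha> *s z))) has_real_derivative 2 * Re \<alpha> * H z) (at 0)"
    unfolding eq by (auto intro!: derivative_eq_intros)
  ultimately show ?thesis using DERIV_unique by blast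
qed

lemma dir_deriv_H_smult:
  assumes z: "z \<noteq> 0" and a: "a \<noteq> 0"
  shows "dir_deriv w H (a *s z) = dir_deriv (cnj a *s w) H z"
proof -
  have inv: "inverse a *s (a *s z) = z" using a by (simp add: vector_smult_assoc)
  have hH: "(H has_derivative frechet_derivative H (at z)) (at z)"
    using H_differentiable[OF z] frechet_derivative_works by blast
  have "((\<lambda>x. inverse a *s x) has_derivative (\<lambda>v. inverse a *s v)) (at (a *s z))"
    by (rule bounded_linear_imp_has_derivative[OF bounded_linear_vector_smult])
  from has_derivative_compose[OF this, of H "frechet_derivative H (at z)"]
  have "((\<lambda>x. H (inverse a *s x)) has_derivative (\<lambda>v. dir_deriv (inverse a *s v) H z)) (at (a *s z))"
    using hH unfolding inv .
  from has_derivative_mult_right[OF this, of "(cmod a)\<^sup>2"]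
  have "((\<lambda>x. (cmod a)\<^sup>2 * H (inverse a *s x)) has_derivative
      (\<lambda>v. (cmod a)\<^sup>2 * dir_deriv (inverse a *s v) H z)) (at (a *s z))" .
  moreover have "(\<lambda>x. (cmod a)\<^sup>2 * H (inverse a *s x)) = H"
    using a by (simp add: homogeneous[symmetric] vector_smult_assoc)
  ultimately have "dir_deriv w H (a *s z) = (cmod a)\<^sup>2 * dir_deriv (inverse a *s w) H z"
    using dir_deriv_eqI by metis
  also have "\<dots> = dir_deriv ((cmod a)\<^sup>2 *\<^sub>R (inverse a *s w)) H z"
    by (simp add: dir_deriv_H_linear(2)[OF z])
  also have "(cmod a)\<^sup>2 *\<^sub>R (inverse a *s w) = cnj a *s w"
  proof -
    have "of_real ((cmod a)\<^sup>2) * inverse a = cnj a"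
      using a unfolding complex_norm_square by simp
    then show ?thesis by (simp only: scaleR_eq_vector_smult vector_smult_assoc)
  qed
  finally show ?thesis .
qed

text \<open>Second derivatives with one direction in the complex line of \<open>z\<close> reduce to first derivatives;
  here by differentiating \<open>dir_deriv_H_smult\<close> along that line, below by differentiating \<open>H_radial\<close>
  in an arbitrary direction.\<close>

lemma second_deriv_H_radial_left:
  assumes z: "z \<noteq> 0"
  shows "dir_deriv (\<alpha> *s z) (dir_deriv w H) z = dir_deriv (cnj \<alpha> *s w) H z"
proof -
  have "((\<lambda>t. dir_deriv w H (z + t *\<^sub>R (\<alpha> *s z))) has_real_derivative
      dir_deriv (\<alpha> *s z) (dir_deriv w H) z) (at 0)"
    using has_real_derivative_along_line[of "dir_deriv w H" z 0 "\<alpha> *s z"]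
      dir_deriv_H_differentiable[OF z] by simp
  moreover have ev: "\<forall>\<^sub>F t in nhds 0. dir_deriv w H z + t * dir_deriv (cnj \<alpha> *s w) H z
      = dir_deriv w H (z + t *\<^sub>R (\<alpha> *s z))"
  proof -
    have "((\<lambda>t. 1 + of_real t * \<alpha>) \<longlongrightarrow> 1 + of_real 0 * \<alpha>) (nhds (0 :: real))"
      by (intro tendsto_intros filterlim_ident)
    then have "\<forall>\<^sub>F t in nhds (0::real). 1 + of_real t * \<alpha> \<in> - {0}"
      by (rule topological_tendstoD) auto
    then show ?thesis
    proof eventually_elim
      case (elim t)
      have e: "z + t *\<^sub>R (\<alpha> *s z) = (1 + of_real t * \<alpha>) *s z"
        by (simp only: scaleR_eq_vector_smult vector_smult_assoc vector_sadd_rdistrib vector_smult_lid)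
      have "cnj (1 + of_real t * \<alpha>) *s w = w + t *\<^sub>R (cnj \<alpha> *s w)"
        by (simp add: scaleR_eq_vector_smult vector_smult_assoc vector_sadd_rdistrib)
      then have "dir_deriv w H (z + t *\<^sub>R (\<alpha> *s z)) = dir_deriv (w + t *\<^sub>R (cnj \<alpha> *s w)) H z"
        unfolding e using dir_deriv_H_smult[OF z, of "1 + of_real t * \<alpha>" w] elim by simp
      then show ?case by (simp add: dir_deriv_H_linear[OF z])
    qed
  qed
  moreover have "((\<lambda>t. dir_deriv w H z + t * dir_deriv (cnj \<alpha> *s w) H z) has_real_derivative
      dir_deriv (cnj \<alpha> *s w) H z) (at 0)"
    by (auto intro!: derivative_eq_intros)
  ultimately show ?thesis
    using DERIV_unique iffD1[OF DERIV_cong_ev[OF refl ev refl]] by blast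
qed

lemma second_deriv_H_radial_right:
  assumes z: "z \<noteq> 0"
  shows "dir_deriv v (dir_deriv (\<alpha> *s z) H) z = dir_deriv (cnj \<alpha> *s v) H z"
proof -
  have line: "((\<lambda>t. dir_deriv u H (z + t *\<^sub>R v)) has_real_derivative
      dir_deriv v (dir_deriv u H) z) (at 0)" for u
    using has_real_derivative_along_line[of "dir_deriv u H" z 0 v]
      dir_deriv_H_differentiable[OF z] by simp
  have lineH: "((\<lambda>t. H (z + t *\<^sub>R v)) has_real_derivative dir_deriv v H z) (at 0)"
    using has_real_derivative_along_line[of H z 0 v] H_differentiable[OF z] by simp
  have "((\<lambda>t. dir_deriv (\<alpha> *s z) H (z + t *\<^sub>R v) + t * dir_deriv (\<alpha> *s v) H (z + t *\<^sub>R v))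
      has_real_derivative (dir_deriv v (dir_deriv (\<alpha> *s z) H) z + dir_deriv (\<alpha> *s v) H z)) (at 0)"
    by (auto intro!: derivative_eq_intros line)
  moreover have ev: "\<forall>\<^sub>F t in nhds 0. 2 * Re \<alpha> * H (z + t *\<^sub>R v)
      = dir_deriv (\<alpha> *s z) H (z + t *\<^sub>R v) + t * dir_deriv (\<alpha> *s v) H (z + t *\<^sub>R v)"
  proof -
    have "((\<lambda>t. z + t *\<^sub>R v) \<longlongrightarrow> z + 0 *\<^sub>R v) (nhds (0 :: real))"
      by (intro tendsto_intros filterlim_ident)
    then have "\<forall>\<^sub>F t in nhds (0::real). z + t *\<^sub>R v \<in> - {0}"
      by (rule topological_tendstoD) (use z in auto)
    then show ?thesis
    proof eventually_elim
      case (elim t)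
      then have nz: "z + t *\<^sub>R v \<noteq> 0" by simp
      have "\<alpha> *s (z + t *\<^sub>R v) = \<alpha> *s z + t *\<^sub>R (\<alpha> *s v)"
        by (simp add: scaleR_eq_vector_smult vector_smult_assoc vector_add_ldistrib mult.commute)
      then show ?case using H_radial[OF nz, of \<alpha>] by (simp add: dir_deriv_H_linear[OF nz])
    qed
  qed
  moreover have "((\<lambda>t. 2 * Re \<alpha> * H (z + t *\<^sub>R v)) has_real_derivative 2 * Re \<alpha> * dir_deriv v H z) (at 0)"
    by (rule DERIV_cmult[OF lineH])
  ultimately have "dir_deriv v (dir_deriv (\<alpha> *s z) H) z + dir_deriv (\<alpha> *s v) H z
      = 2 * Re \<alpha> * dir_deriv v H z"
    using DERIV_unique iffD1[OF DERIV_cong_ev[OF refl ev refl]] by blast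
  moreover have "(2 * Re \<alpha>) *\<^sub>R v = \<alpha> *s v + cnj \<alpha> *s v"
    by (simp add: vec_eq_iff complex_eq_iff algebra_simps)
  then have "2 * Re \<alpha> * dir_deriv v H z = dir_deriv (\<alpha> *s v) H z + dir_deriv (cnj \<alpha> *s v) H z"
    using dir_deriv_H_linear(1,2)[OF z] by (metis real_scaleR_def)
  ultimately show ?thesis by simp
qed

lemma second_deriv_H_rotate:
  assumes z: "z \<noteq> 0" and a: "cmod a = 1"
  shows "dir_deriv v (dir_deriv w H) (a *s z) = dir_deriv (cnj a *s v) (dir_deriv (cnj a *s w) H) z"
proof -
  have a0: "a \<noteq> 0" using a by auto
  have ca: "a * cnj a = 1" using a complex_norm_square[of a] by simp
  then have inv: "cnj a *s (a *s x) = x" "a *s (cnj a *s x) = x" for x :: "complex^'n"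
    by (simp_all add: vector_smult_assoc mult.commute)
  have az: "a *s z \<noteq> 0" using z inv(1)[of z] by auto
  have hH: "(dir_deriv u H has_derivative frechet_derivative (dir_deriv u H) (at z)) (at z)" for u
    using dir_deriv_H_differentiable[OF z] frechet_derivative_works by blast
  have "((\<lambda>x. cnj a *s x) has_derivative (\<lambda>v. cnj a *s v)) (at (a *s z))"
    by (rule bounded_linear_imp_has_derivative[OF bounded_linear_vector_smult])
  from has_derivative_compose[OF this, of "dir_deriv (cnj a *s w) H"]
  have "((\<lambda>x. dir_deriv (cnj a *s w) H (cnj a *s x)) has_derivative
      (\<lambda>v. dir_deriv (cnj a *s v) (dir_deriv (cnj a *s w) H) z)) (at (a *s z))"
    unfolding inv using hH .
  then have "(dir_deriv w H has_derivative
      (\<lambda>v. dir_deriv (cnj a *s v) (dir_deriv (cnj a *s w) H) z)) (at (a *s z))"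
  proof (rule has_derivative_transform_within_open[OF _ open_punctured])
    show "a *s z \<in> UNIV - {0}" using az by simp
    fix x :: "complex^'n" assume "x \<in> UNIV - {0}"
    then have "cnj a *s x \<noteq> 0" using inv(2)[of x] by auto
    from dir_deriv_H_smult[OF this a0, of w]
    show "dir_deriv (cnj a *s w) H (cnj a *s x) = dir_deriv w H x" unfolding inv by simp
  qed
  then show ?thesis by (rule dir_deriv_eqI)
qed

lemma second_deriv_H_expand:
  assumes z: "z \<noteq> 0"
  shows "dir_deriv v (dir_deriv w H) z =
    (\<Sum>a\<in>Basis. \<Sum>b\<in>Basis. (v \<bullet> a) * (w \<bullet> b) * dir_deriv a (dir_deriv b H) z)"
proof -
  have l: "linear (\<lambda>w. dir_deriv v (dir_deriv w H) z)" for v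
    using second_deriv_H_bilinear[OF z] by (intro linearI) auto
  have e: "dir_deriv v (dir_deriv w H) z = (\<Sum>b\<in>Basis. (w \<bullet> b) * dir_deriv v (dir_deriv b H) z)" for v
  proof -
    have "dir_deriv v (dir_deriv w H) z
        = dir_deriv v (dir_deriv (\<Sum>b\<in>Basis. (w \<bullet> b) *\<^sub>R b) H) z"
      by (simp add: euclidean_representation)
    also have "\<dots> = (\<Sum>b\<in>Basis. (w \<bullet> b) * dir_deriv v (dir_deriv b H) z)"
      using linear_sum[OF l[of v], of "\<lambda>b. (w \<bullet> b) *\<^sub>R b" Basis] linear_cmul[OF l[of v]] by simp
    finally show ?thesis .
  qed
  have "dir_deriv v (dir_deriv w H) z = (\<Sum>a\<in>Basis. (v \<bullet> a) * dir_deriv a (dir_deriv w H) z)"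
    using dir_deriv_expand[of "dir_deriv w H" z v, OF dir_deriv_H_differentiable[OF z]] by simp
  also have "\<dots> = (\<Sum>a\<in>Basis. (v \<bullet> a) * (\<Sum>b\<in>Basis. (w \<bullet> b) * dir_deriv a (dir_deriv b H) z))"
    by (simp only: e)
  finally show ?thesis by (simp add: sum_distrib_left mult.assoc)
qed

lemma continuous_on_second_deriv_H:
  assumes "continuous_on (UNIV - {0}) f" "continuous_on (UNIV - {0}) g"
  shows "continuous_on (UNIV - {0}) (\<lambda>z. dir_deriv (f z) (dir_deriv (g z) H) z)"
proof -
  have c: "continuous_on (UNIV - {0}) (dir_deriv a (dir_deriv b H))" for a b
    using Ck_on_continuous_on[OF Ck_on_dir_deriv[OF Ck_on_dir_deriv[OF smooth]]] .
  have "continuous_on (UNIV - {0}) (\<lambda>z. \<Sum>a\<in>Basis. \<Sum>b\<in>Basis.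
      (f z \<bullet> a) * (g z \<bullet> b) * dir_deriv a (dir_deriv b H) z)"
    by (intro continuous_on_sum continuous_on_mult continuous_on_inner continuous_on_const assms c)
  then show ?thesis
    by (rule continuous_on_eq) (use second_deriv_H_expand in \<open>simp\<close>)
qed

end

section \<open>The obstruction and its zeros\<close>

text \<open>Every real quadratic form on \<open>\<complex>\<close> is \<open>c \<bar>\<beta>\<bar>\<^sup>2 + Re (q \<beta>\<^sup>2)\<close>; this is \<open>q\<close> for the form
  \<open>B \<beta> \<beta>\<close>.\<close>

definition holomorphic_coeff :: "(complex \<Rightarrow> complex \<Rightarrow> real) \<Rightarrow> complex" where
  "holomorphic_coeff B = Complex ((B 1 1 - B \<i> \<i>) / 2) (- (B 1 \<i> + B \<i> 1) / 2)"

definition real_bilinear :: "(complex \<Rightarrow> complex \<Rightarrow> real) \<Rightarrow> bool" where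
  "real_bilinear B \<longleftrightarrow> (\<forall>x. linear (B x)) \<and> (\<forall>y. linear (\<lambda>x. B x y))"

lemma real_bilinear_expand:
  assumes "real_bilinear B"
  shows "B x y = Re x * Re y * B 1 1 + Re x * Im y * B 1 \<i> + Im x * Re y * B \<i> 1 + Im x * Im y * B \<i> \<i>"
proof -
  have e: "x = Re x *\<^sub>R 1 + Im x *\<^sub>R \<i>" for x by (simp add: complex_eq_iff)
  have l: "linear (B x)" "linear (\<lambda>x. B x y)" for x y using assms by (auto simp: real_bilinear_def)
  have 1: "B x y = Re x * B 1 y + Im x * B \<i> y" for y
    using linear_add[OF l(2), of "Re x *\<^sub>R 1" "Im x *\<^sub>R \<i>" y] linear_cmul[OF l(2)] e[of x] by simp
  have 2: "B u y = Re y * B u 1 + Im y * B u \<i>" for u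
    using linear_add[OF l(1), of u "Re y *\<^sub>R 1" "Im y *\<^sub>R \<i>"] linear_cmul[OF l(1)] e[of y] by simp
  show ?thesis unfolding 1 2[of 1] 2[of \<i>] by (simp add: algebra_simps)
qed

lemma holomorphic_coeff_rotate:
  assumes "real_bilinear B"
  shows "holomorphic_coeff (\<lambda>x y. B (\<mu> * x) (\<mu> * y)) = \<mu>\<^sup>2 * holomorphic_coeff B"
  unfolding holomorphic_coeff_def
  unfolding real_bilinear_expand[OF assms, of "\<mu> * _"]
  by (simp add: complex_eq_iff power2_eq_square field_simps)

lemma holomorphic_coeff_zero:
  assumes "real_bilinear B" "holomorphic_coeff B = 0"
  shows "B x x = (cmod x)\<^sup>2 * B 1 1"
proof -
  have "B \<i> \<i> = B 1 1" "B \<i> 1 = - B 1 \<i>"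
    using assms(2) by (auto simp: holomorphic_coeff_def complex_eq_iff)
  then show ?thesis
    unfolding real_bilinear_expand[OF assms(1), of x x] cmod_power2
    by (simp add: algebra_simps power2_eq_square)
qed

text \<open>A complement of the complex line of \<open>z\<close> that depends continuously on \<open>z\<close>. It cannot be chosen
  complex linearly: this one is antilinear, and that is where the weight \<open>-4\<close> of the obstruction
  comes from.\<close>

definition perp :: "complex^2 \<Rightarrow> complex^2" where
  "perp z = (\<chi> i. if i = 1 then - cnj (z $ 2) else cnj (z $ 1))"

lemma perp_smult: "perp (a *s z) = cnj a *s perp z"
  by (simp add: perp_def vec_eq_iff)

lemma continuous_on_perp: "continuous_on X perp"
  unfolding perp_def[abs_def]
proof (rule continuous_on_vec_lambda)
  show "continuous_on X (\<lambda>z. if i = 1 then - cnj (z $ 2) else cnj (z $ 1))" for i :: 2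
    by (cases "i = 1") (auto intro!: continuous_intros)
qed

locale circular_homogeneous_2 = circular_homogeneous H for H :: "complex^2 \<Rightarrow> real"
begin

text \<open>The \<open>(2,0)\<close> part of the Hessian of \<open>H\<close> annihilates the vector \<open>z\<close>, so it is determined by this
  single complex number.\<close>

definition obstruction :: "complex^2 \<Rightarrow> complex" where
  "obstruction z = holomorphic_coeff
     (\<lambda>x y. dir_deriv (x *s perp z) (dir_deriv (y *s perp z) H) z)"

lemma real_bilinear_second_deriv:
  assumes "z \<noteq> 0"
  shows "real_bilinear (\<lambda>x y. dir_deriv (x *s u) (dir_deriv (y *s u) H) z)"
proof -
  have s: "(c *\<^sub>R x) *s u = c *\<^sub>R (x *s u)" for c x
    by (simp add: scaleR_eq_vector_smult vector_smult_assoc) (simp add: scaleR_conv_of_real)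
  show ?thesis unfolding real_bilinear_def
    by (intro conjI allI linearI)
      (simp_all add: s vector_sadd_rdistrib second_deriv_H_bilinear[OF assms])
qed

text \<open>Rotating the base point by \<open>a\<close> rotates the two directions by \<open>cnj a\<close>, and \<open>perp\<close> contributes
  another \<open>cnj a\<close>; a quadratic coefficient scales by the square of the product.\<close>

lemma obstruction_rotate:
  assumes "z \<noteq> 0" "cmod a = 1"
  shows "obstruction (a *s z) = cnj a ^ 4 * obstruction z"
proof -
  have "obstruction (a *s z) = holomorphic_coeff (\<lambda>x y.
      dir_deriv (((cnj a)\<^sup>2 * x) *s perp z) (dir_deriv (((cnj a)\<^sup>2 * y) *s perp z) H) z)"
    unfolding obstruction_def perp_smult second_deriv_H_rotate[OF assms] vector_smult_assoc
    by (simp add: power2_eq_square mult_ac)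
  also have "\<dots> = ((cnj a)\<^sup>2)\<^sup>2 * obstruction z"
    unfolding obstruction_def
    by (rule holomorphic_coeff_rotate[OF real_bilinear_second_deriv[OF assms(1)]])
  finally show ?thesis by simp
qed

lemma continuous_on_obstruction: "continuous_on (UNIV - {0}) obstruction"
proof -
  have c: "continuous_on (UNIV - {0}) (\<lambda>z. dir_deriv (x *s perp z) (dir_deriv (y *s perp z) H) z)" for x y
    by (intro continuous_on_second_deriv_H continuous_on_vector_smult continuous_on_const continuous_on_perp)
  show ?thesis
    unfolding obstruction_def[abs_def] holomorphic_coeff_def complex_eq complex.sel
    by (intro continuous_intros c) auto
qed

end

text \<open>The map \<open>x \<mapsto> (sqrt (1 - \<bar>x\<bar>\<^sup>2), x)\<close> embeds the disc into the unit sphere, and its boundary is an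
  orbit of the circle action. If \<open>Q\<close> had no zeros, it would have a continuous logarithm on the disc,
  but along the boundary \<open>Q\<close> winds \<open>-4\<close> times around the origin.\<close>

lemma equivariant_map_has_zero:
  fixes Q :: "complex^2 \<Rightarrow> complex"
  assumes cont: "continuous_on (UNIV - {0}) Q"
    and equi: "\<And>a z. z \<noteq> 0 \<Longrightarrow> cmod a = 1 \<Longrightarrow> Q (a *s z) = cnj a ^ 4 * Q z"
  obtains z where "z \<noteq> 0" "Q z = 0"
proof (rule ccontr)
  assume "\<not> thesis"
  with that have nz: "Q z \<noteq> 0" if "z \<noteq> 0" for z using \<open>z \<noteq> 0\<close> by blast
  define e :: "complex \<Rightarrow> complex^2"
    where "e x = (\<chi> i. if i = 1 then of_real (sqrt (1 - (cmod x)\<^sup>2)) else x)" for x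
  have e0: "e x \<noteq> 0" for x by (cases "x = 0") (auto simp: e_def vec_eq_iff forall_2)
  have ce: "continuous_on X e" for X
    unfolding e_def[abs_def]
  proof (rule continuous_on_vec_lambda)
    show "continuous_on X (\<lambda>x. if i = 1 then of_real (sqrt (1 - (cmod x)\<^sup>2)) else x)" for i :: 2
      by (cases "i = 1") (auto intro!: continuous_intros)
  qed
  have "continuous_on (cball 0 1) (\<lambda>x. Q (e x))"
    by (rule continuous_on_compose2[OF cont ce]) (use e0 in auto)
  then obtain h where h: "continuous_on (cball 0 1) h" "\<And>x. x \<in> cball 0 1 \<Longrightarrow> Q (e x) = exp (h x)"
    using continuous_logarithm_on_cball[of 0 1 "\<lambda>x. Q (e x)"] nz[OF e0] by metis
  have ecis: "e (cis t) = cis t *s e 1" for t by (simp add: e_def vec_eq_iff)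
  \<comment> \<open>Adding \<open>4 \<i> t\<close> cancels the winding, so \<open>k\<close> is a continuous logarithm of a constant and hence
    constant, while \<open>h (cis t)\<close> has period \<open>2 \<pi>\<close>.\<close>
  define k where "k t = h (cis t) + \<i> * of_real (4 * t)" for t
  have ck: "continuous_on UNIV k"
    unfolding k_def[abs_def]
    by (intro continuous_intros continuous_on_compose2[OF h(1)]) auto
  have ek: "exp (k t) = Q (e 1)" for t
  proof -
    have "exp (k t) = Q (e (cis t)) * cis (4 * t)"
      using h(2)[of "cis t"] by (simp add: k_def exp_add cis_conv_exp)
    also have "\<dots> = (cis (-t) ^ 4 * cis (4 * t)) * Q (e 1)"
      unfolding ecis using equi[OF e0[of 1], of "cis t"] by (simp add: cis_cnj)
    also have "cis (-t) ^ 4 * cis (4 * t) = 1"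
      by (simp add: Complex.DeMoivre cis_mult)
    finally show ?thesis by simp
  qed
  have "k constant_on UNIV"
  proof (rule continuous_discrete_range_constant[OF connected_UNIV ck])
    fix x :: real
    have "1 \<le> norm (k y - k x)" if "k y \<noteq> k x" for y
    proof (rule ccontr)
      assume "\<not> ?thesis"
      then have "\<bar>Im (k y) - Im (k x)\<bar> < 1" using abs_Im_le_cmod[of "k y - k x"] by simp
      then have "\<bar>Im (k y) - Im (k x)\<bar> < 2 * pi" using pi_gt3 by linarith
      then have "k y = k x" by (rule exp_complex_eqI) (simp add: ek)
      then show False using that by simp
    qed
    then show "\<exists>e>0. \<forall>y. y \<in> UNIV \<and> k y \<noteq> k x \<longrightarrow> e \<le> norm (k y - k x)"
      by (intro exI[of _ 1]) auto
  qed
  then have "k 0 = k (2 * pi)" by (auto simp: constant_on_def)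
  then show False by (simp add: k_def complex_eq_iff)
qed

section \<open>Projective images of the sphere\<close>

text \<open>Linear maps of the affine plane extend to the projective plane by a block matrix, which
  preserves the first homogeneous coordinate.\<close>

lemma projective_image_linear_sphere:
  fixes e f :: "complex^2"
  assumes det: "e $ 1 * f $ 2 - f $ 1 * e $ 2 \<noteq> 0"
  obtains A :: "complex^3^3" where "invertible A"
    "projective_image A X = (\<lambda>w. w $ 1 *s e + w $ 2 *s f) ` X"
proof -
  define A :: "complex^3^3"
    where "A = vector [vector [1, 0, 0], vector [0, e $ 1, f $ 1], vector [0, e $ 2, f $ 2]]"
  have "det A = e $ 1 * f $ 2 - f $ 1 * e $ 2"
    by (simp add: A_def det_3 algebra_simps)
  then have inv: "invertible A" using det by (simp add: invertible_det_nz)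
  have Aw: "A *v homogeneous w = homogeneous (w $ 1 *s e + w $ 2 *s f)" for w
    by (simp add: A_def homogeneous_def matrix_vector_mult_def vec_eq_iff forall_3 sum_3 algebra_simps)
  have inj: "c *s homogeneous z = homogeneous y \<longleftrightarrow> c = 1 \<and> z = y" for c z y
    by (auto simp: homogeneous_def vec_eq_iff forall_3 forall_2)
  have "projective_image A X = (\<lambda>w. w $ 1 *s e + w $ 2 *s f) ` X"
    unfolding projective_image_def Aw using inj by (auto simp: eq_commute[of "homogeneous _"])
  then show ?thesis using that inv by blast
qed

lemma norm_vec2_square: "(norm (w :: complex^2))\<^sup>2 = (cmod (w $ 1))\<^sup>2 + (cmod (w $ 2))\<^sup>2"
  by (simp add: norm_vec_def L2_set_def sum_2)

lemma Ck_on_cmod_square: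
  fixes L :: "'a::real_normed_vector \<Rightarrow> complex"
  assumes "bounded_linear L" "open U"
  shows "Ck_on k U (\<lambda>z. (cmod (L z))\<^sup>2)"
  unfolding cmod_power2 unfolding power2_eq_square
  by (intro Ck_on_add Ck_on_mult assms(2) Ck_on_bounded_linear
      bounded_linear_compose[OF bounded_linear_Re assms(1)]
      bounded_linear_compose[OF bounded_linear_Im assms(1)])

text \<open>For \<open>w = x p + \<beta> \<tau>\<close> with \<open>\<tau>\<close> complex tangent at \<open>p\<close>, the first and second derivatives of \<open>H\<close> along
  \<open>w\<close> are \<open>2 Re x\<close> and \<open>2 \<bar>x\<bar>\<^sup>2 + c \<bar>\<beta>\<bar>\<^sup>2\<close>, the latter because the obstruction vanishes. So the
  second-order Taylor polynomial of \<open>H\<close> at \<open>p + w\<close> is \<open>\<bar>1 + x\<bar>\<^sup>2 + c / 2 \<bar>\<beta>\<bar>\<^sup>2\<close>, a Hermitian form in the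
  coordinates \<open>(1 + x, \<beta>)\<close> of the point \<open>p + w\<close> itself. The Levi condition makes \<open>c\<close> positive, and the
  unit sphere of this form is a linear image of the round one.\<close>

lemma (in circular_homogeneous_2) osculating_sphere:
  assumes p0: "p \<noteq> 0" and Hp: "H p = 1" and obs: "obstruction p = 0"
    and levi: "\<And>w. w \<noteq> 0 \<Longrightarrow> dir_deriv w H p = 0 \<Longrightarrow> dir_deriv (\<i> *s w) H p = 0 \<Longrightarrow>
      dir_deriv w (dir_deriv w H) p + dir_deriv (\<i> *s w) (dir_deriv (\<i> *s w) H) p > 0"
  shows "projective_umbilic {z. H z = 1} p"
proof -
  define b where "b v w = dir_deriv v (dir_deriv w H) p" for v w
  define m where "m = perp p"
  \<comment> \<open>\<open>a\<close> is the \<open>p\<close>-component of \<open>m\<close> along the complex tangent line, so that \<open>\<tau>\<close> is complex tangent.\<close>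
  define a where "a = Complex (dir_deriv m H p / 2) (- dir_deriv (\<i> *s m) H p / 2)"
  define \<tau> where "\<tau> = m - a *s p"
  note lin = dir_deriv_H_linear[OF p0]
  have badd: "b (u + v) w = b u w + b v w" "b u (v + w) = b u v + b u w" for u v w
    unfolding b_def using second_deriv_H_bilinear[OF p0] by auto
  have rad: "dir_deriv (\<alpha> *s p) H p = 2 * Re \<alpha>" for \<alpha> using H_radial[OF p0] Hp by simp
  have dm: "dir_deriv (\<beta> *s m) H p = 2 * Re (\<beta> * a)" for \<beta>
  proof -
    have "\<beta> *s m = Re \<beta> *\<^sub>R m + Im \<beta> *\<^sub>R (\<i> *s m)"
      by (simp add: vec_eq_iff complex_eq_iff)
    then show ?thesis by (simp add: lin a_def)
  qed
  have m_split: "\<beta> *s m = \<beta> *s \<tau> + (\<beta> * a) *s p" for \<beta>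
    by (simp add: \<tau>_def vec_eq_iff algebra_simps)
  have tang: "dir_deriv (\<beta> *s \<tau>) H p = 0" for \<beta>
    using dm[of \<beta>] rad[of "\<beta> * a"] lin(1)[of "\<beta> *s \<tau>" "(\<beta> * a) *s p"] m_split[of \<beta>] by simp
  have bl: "b (\<alpha> *s p) w = dir_deriv (cnj \<alpha> *s w) H p"
    and br: "b w (\<alpha> *s p) = dir_deriv (cnj \<alpha> *s w) H p" for \<alpha> w
    unfolding b_def using second_deriv_H_radial_left[OF p0] second_deriv_H_radial_right[OF p0] by auto
  have mixed: "b (\<alpha> *s p) (\<beta> *s \<tau>) = 0" "b (\<beta> *s \<tau>) (\<alpha> *s p) = 0" for \<alpha> \<beta>
    unfolding bl br vector_smult_assoc by (rule tang)+
  have bpp: "b (\<alpha> *s p) (\<alpha> *s p) = 2 * (cmod \<alpha>)\<^sup>2" for \<alpha>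
    unfolding bl vector_smult_assoc rad cmod_power2 by (simp add: power2_eq_square)
  have bsplit: "b (\<alpha> *s p + \<beta> *s \<tau>) (\<alpha> *s p + \<beta> *s \<tau>) = 2 * (cmod \<alpha>)\<^sup>2 + b (\<beta> *s \<tau>) (\<beta> *s \<tau>)" for \<alpha> \<beta>
    by (simp add: badd mixed bpp)
  have bm: "b (\<beta> *s m) (\<beta> *s m) = (cmod \<beta>)\<^sup>2 * b m m" for \<beta>
    using holomorphic_coeff_zero[OF real_bilinear_second_deriv[OF p0, of m]] obs
    by (simp add: obstruction_def m_def b_def)
  define c where "c = b m m - 2 * (cmod a)\<^sup>2"
  have b\<tau>: "b (\<beta> *s \<tau>) (\<beta> *s \<tau>) = (cmod \<beta>)\<^sup>2 * c" for \<beta>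
    using bm[of \<beta>] bsplit[of "\<beta> * a" \<beta>] m_split[of \<beta>]
    by (simp add: c_def add.commute norm_mult power_mult_distrib algebra_simps)
  define \<Delta> where "\<Delta> = p $ 1 * \<tau> $ 2 - \<tau> $ 1 * p $ 2"
  have "\<Delta> = of_real ((norm p)\<^sup>2)"
    unfolding norm_vec2_square of_real_add complex_norm_square
    by (simp add: \<Delta>_def \<tau>_def m_def perp_def algebra_simps)
  then have \<Delta>: "\<Delta> \<noteq> 0" using p0 by simp
  then have \<tau>0: "\<tau> \<noteq> 0" by (auto simp: \<Delta>_def)
  have c: "c > 0"
  proof -
    have "b \<tau> \<tau> + b (\<i> *s \<tau>) (\<i> *s \<tau>) > 0"
      unfolding b_def using levi[OF \<tau>0] tang[of 1] tang[of \<i>] by simp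
    then show ?thesis using b\<tau>[of 1] b\<tau>[of \<i>] by simp
  qed
  define \<alpha> where "\<alpha> q = (q $ 1 * \<tau> $ 2 - \<tau> $ 1 * q $ 2) / \<Delta>" for q :: "complex^2"
  define \<beta> where "\<beta> q = (p $ 1 * q $ 2 - q $ 1 * p $ 2) / \<Delta>" for q :: "complex^2"
  have coord: "q = \<alpha> q *s p + \<beta> q *s \<tau>" for q
  proof -
    have "\<alpha> q * p $ i + \<beta> q * \<tau> $ i = q $ i" if "i = 1 \<or> i = 2" for i
    proof -
      have "\<Delta> * (\<alpha> q * p $ i + \<beta> q * \<tau> $ i) = \<Delta> * q $ i"
        using that \<Delta> by (auto simp: \<alpha>_def \<beta>_def distrib_left) (auto simp: \<Delta>_def algebra_simps)
      then show ?thesis using \<Delta> by simp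
    qed
    then show ?thesis by (simp add: vec_eq_iff forall_2)
  qed
  have coord_unique: "\<alpha> (x *s p + y *s \<tau>) = x" "\<beta> (x *s p + y *s \<tau>) = y" for x y
    using \<Delta> by (auto simp: \<alpha>_def \<beta>_def nonzero_divide_eq_eq) (auto simp: \<Delta>_def algebra_simps)
  define \<rho> where "\<rho> q = (cmod (\<alpha> q))\<^sup>2 + c / 2 * (cmod (\<beta> q))\<^sup>2 - 1" for q
  have \<alpha>p: "\<alpha> p = 1" and \<beta>p: "\<beta> p = 0"
    using coord_unique[of 1 0] by auto
  have bl\<alpha>: "bounded_linear \<alpha>" and bl\<beta>: "bounded_linear \<beta>"
    unfolding \<alpha>_def[abs_def] \<beta>_def[abs_def]
    by (intro bounded_linear_compose[OF bounded_linear_divide] bounded_linear_sub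
        bounded_linear_compose[OF bounded_linear_mult_left]
        bounded_linear_compose[OF bounded_linear_mult_right] bounded_linear_vec_nth)+
  have C\<rho>: "Ck_on k U \<rho>" if "open U" for k U
  proof -
    have "Ck_on k U (\<lambda>q. (cmod (\<alpha> q))\<^sup>2 + c / 2 * (cmod (\<beta> q))\<^sup>2 + - 1)"
      by (intro Ck_on_add Ck_on_mult Ck_on_cmod_square bl\<alpha> bl\<beta> that Ck_on_const)
    then show ?thesis by (simp add: \<rho>_def[abs_def])
  qed
  \<comment> \<open>Rescaling \<open>\<tau>\<close> by \<open>s\<close> turns \<open>\<bar>\<alpha>\<bar>\<^sup>2 + c / 2 \<bar>\<beta>\<bar>\<^sup>2\<close> into the standard Hermitian form.\<close>
  define s where "s = sqrt (2 / c)"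
  have s: "s > 0" "s\<^sup>2 = 2 / c" using c by (auto simp: s_def)
  define f where "f = of_real s *s \<tau>"
  have "p $ 1 * f $ 2 - f $ 1 * p $ 2 = of_real s * \<Delta>"
    by (simp add: f_def \<Delta>_def algebra_simps)
  then have fdet: "p $ 1 * f $ 2 - f $ 1 * p $ 2 \<noteq> 0" using s \<Delta> by simp
  obtain A :: "complex^3^3" where A: "invertible A"
    "projective_image A (sphere 0 1) = (\<lambda>w :: complex^2. w $ 1 *s p + w $ 2 *s f) ` sphere 0 1"
    by (rule projective_image_linear_sphere[OF fdet])
  define T where "T = projective_image A (sphere 0 1)"
  have T: "q \<in> T \<longleftrightarrow> \<rho> q = 0" for q
  proof
    assume "q \<in> T"
    then obtain w :: "complex^2" where w: "norm w = 1" "q = w $ 1 *s p + w $ 2 *s f" by (auto simp: T_def A)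
    then have "q = w $ 1 *s p + (w $ 2 * of_real s) *s \<tau>" by (simp add: f_def vector_smult_assoc)
    then have "\<alpha> q = w $ 1" "\<beta> q = w $ 2 * of_real s" using coord_unique by auto
    then have "\<rho> q = (norm w)\<^sup>2 - 1"
      using s c by (simp add: \<rho>_def norm_mult power_mult_distrib norm_vec2_square)
    then show "\<rho> q = 0" using w by simp
  next
    assume q: "\<rho> q = 0"
    define w :: "complex^2" where "w = (\<chi> i. if i = 1 then \<alpha> q else \<beta> q / of_real s)"
    have w: "w $ 1 = \<alpha> q" "w $ 2 = \<beta> q / of_real s" by (auto simp: w_def)
    have "(cmod (\<beta> q / of_real s))\<^sup>2 = c / 2 * (cmod (\<beta> q))\<^sup>2"
      using s c by (simp add: norm_divide power_divide)
    then have "(norm w)\<^sup>2 = 1" using q unfolding norm_vec2_square w \<rho>_def by simp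
    then have "norm w = 1" using power2_eq_1_iff[of "norm w"] norm_ge_zero[of w] by auto
    moreover have "q = w $ 1 *s p + w $ 2 *s f"
      using s coord[of q] by (simp add: w f_def vector_smult_assoc)
    ultimately show "q \<in> T" by (auto simp: T_def A)
  qed
  obtain K where K: "\<forall>\<^sub>F q in nhds p.
    \<bar>H q - H p - dir_deriv (q - p) H p - dir_deriv (q - p) (dir_deriv (q - p) H) p / 2\<bar>
      \<le> K * norm (q - p) ^ 3"
    using Taylor_order_2[OF open_punctured _ smooth] p0 by auto
  have Taylor_eq: "H q - H p - dir_deriv (q - p) H p - dir_deriv (q - p) (dir_deriv (q - p) H) p / 2
      = (H q - 1) - \<rho> q" for q
  proof -
    define x where "x = \<alpha> q - 1"
    have e: "q - p = x *s p + \<beta> q *s \<tau>"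
      using coord[of q] by (simp add: x_def vector_ssub_ldistrib vec_eq_iff algebra_simps)
    have 1: "dir_deriv (q - p) H p = 2 * Re x"
      unfolding e by (simp add: lin(1) rad tang)
    have 2: "dir_deriv (q - p) (dir_deriv (q - p) H) p = 2 * (cmod x)\<^sup>2 + (cmod (\<beta> q))\<^sup>2 * c"
      unfolding b_def[symmetric] e bsplit b\<tau> ..
    have "(cmod (\<alpha> q))\<^sup>2 = 1 + 2 * Re x + (cmod x)\<^sup>2"
      unfolding cmod_power2 x_def by (simp add: power2_eq_square algebra_simps)
    then show ?thesis unfolding 1 2 by (simp add: Hp \<rho>_def add_divide_distrib)
  qed
  have "contact_order_ge 3 {z. H z = 1} T p"
  proof (rule contact_order_ge_of_defining_functions[OF open_punctured])
    show "p \<in> UNIV - {0}" using p0 by simp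
    have "Ck_on k (UNIV - {0}) (\<lambda>q. H q + - 1)" for k
      by (intro Ck_on_add open_punctured smooth Ck_on_const)
    then show "Ck_on 1 (UNIV - {0}) (\<lambda>q. H q - 1)" by (simp add: One_nat_def[symmetric] del: One_nat_def)
    show "Ck_on 1 (UNIV - {0}) \<rho>" by (rule C\<rho>[OF open_punctured])
    show "H p - 1 = 0" using Hp by simp
    have "((\<lambda>q. H q - 1) has_derivative (\<lambda>v. dir_deriv v H p - 0)) (at p)"
      using H_differentiable[OF p0] frechet_derivative_works by (intro has_derivative_diff) auto
    from dir_deriv_eqI[OF this, of p] show "dir_deriv p (\<lambda>q. H q - 1) p \<noteq> 0"
      using rad[of 1] by simp
    show "\<forall>\<^sub>F q in nhds p. q \<in> {z. H z = 1} \<longleftrightarrow> H q - 1 = 0" by simp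
    show "\<forall>\<^sub>F q in nhds p. q \<in> T \<longleftrightarrow> \<rho> q = 0" by (simp add: T)
    show "\<forall>\<^sub>F q in nhds p. \<bar>H q - 1 - \<rho> q\<bar> \<le> K * norm (q - p) ^ 3"
      using K unfolding Taylor_eq .
  qed
  moreover have "p \<in> T" by (simp add: T \<rho>_def \<alpha>p \<beta>p)
  ultimately show ?thesis
    unfolding projective_umbilic_def using A(1) Hp by (auto simp: T_def)
qed

section \<open>Circles of projective-umbilic points\<close>

lemma is_circle_orbit:
  fixes p :: "complex^'n"
  assumes "p \<noteq> 0"
  shows "is_circle (range (\<lambda>t. cis t *s p))"
proof -
  define u where "u = (1 / norm p) *\<^sub>R p"
  define v where "v = \<i> *s u"
  have "norm u = 1" using assms by (simp add: u_def)
  moreover have "norm v = 1" using \<open>norm u = 1\<close> by (simp add: v_def norm_vector_smult_complex)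
  moreover have "u \<bullet> v = 0"
    by (simp add: v_def inner_vec_def inner_complex_def)
  moreover have "cis t *s p = 0 + (norm p * cos t) *\<^sub>R u + (norm p * sin t) *\<^sub>R v" for t
    using assms by (simp add: u_def v_def vec_eq_iff complex_eq_iff)
  ultimately show ?thesis
    unfolding is_circle_def using assms
    by (intro exI[of _ 0] exI[of _ "norm p"] exI[of _ u] exI[of _ v]) simp
qed

theorem theorem7:
  fixes \<Omega> :: "(complex^2) set"
  assumes "open \<Omega>" and "connected \<Omega>" and "\<Omega> \<noteq> {}" and "bounded \<Omega>"
    and "smooth_boundary \<Omega>"
    and "strongly_pseudoconvex \<Omega>"
    and "complete_circular \<Omega>"
  shows "\<exists>C. is_circle C \<and> C \<subseteq> frontier \<Omega> \<and>
           (\<forall>p\<in>C. projective_umbilic (frontier \<Omega>) p)"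
proof -
  interpret circular_domain \<Omega> using assms by unfold_locales
  interpret circular_homogeneous_2 gauge_sq
    by unfold_locales (simp_all add: Ck_on_gauge_sq gauge_sq_def gauge_smult power2_eq_square)
  have S: "frontier \<Omega> = {z. gauge_sq z = 1}"
  proof -
    have "N z * N z = 1 \<longleftrightarrow> N z = 1" for z
      using gauge_nonneg[of z] by (auto simp: square_eq_1_iff)
    then show ?thesis by (auto simp: gauge_sq_def gauge_eq_1_iff)
  qed
  \<comment> \<open>Composing with the radial projection places the zero on the boundary.\<close>
  define Q where "Q z = obstruction (radial_proj z)" for z
  have proj0: "radial_proj z \<noteq> 0" if "z \<noteq> 0" for z
    using frontier_nonzero[OF radial_proj_frontier[OF that]] .
  have "continuous_on (UNIV - {0}) Q"
    unfolding Q_def[abs_def]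
    by (rule continuous_on_compose2[OF continuous_on_obstruction continuous_on_radial_proj])
      (use proj0 in auto)
  moreover have "Q (a *s z) = cnj a ^ 4 * Q z" if "z \<noteq> 0" "cmod a = 1" for a z
  proof -
    have "radial_proj (a *s z) = a *s radial_proj z"
      using that(2)
      by (simp add: radial_proj_def gauge_smult scaleR_eq_vector_smult vector_smult_assoc mult.commute)
    then show ?thesis unfolding Q_def using obstruction_rotate[OF proj0[OF that(1)] that(2)] by simp
  qed
  ultimately obtain z where z: "z \<noteq> 0" "Q z = 0" using equivariant_map_has_zero by blast
  define p where "p = radial_proj z"
  define C where "C = range (\<lambda>t. cis t *s p)"
  have pf: "p \<in> frontier \<Omega>" using radial_proj_frontier[OF z(1)] by (simp add: p_def)
  have Cf: "C \<subseteq> frontier \<Omega>" using rotate_frontier[OF pf] by (auto simp: C_def)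
  have "projective_umbilic (frontier \<Omega>) q" if q: "q \<in> C" for q
  proof -
    have qf: "q \<in> frontier \<Omega>" using Cf q by blast
    obtain t where t: "q = cis t *s p" using q by (auto simp: C_def)
    have "obstruction q = 0"
      using obstruction_rotate[OF frontier_nonzero[OF pf], of "cis t"] z(2) by (simp add: t Q_def p_def)
    then show ?thesis
      unfolding S using osculating_sphere[OF frontier_nonzero[OF qf]] gauge_sq_levi_positive[OF qf] qf S
      by blast
  qed
  moreover have "is_circle C" unfolding C_def by (rule is_circle_orbit[OF frontier_nonzero[OF pf]])
  ultimately show ?thesis using Cf by blast
qed

end
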